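(* Let $k\ge 2$ and $n\ge 3k$ be integers. Let $G$ be a connected graph on $n$ vertices with minimum degree $\delta(G)\ge 2$, with $\alpha'(G)\ge \frac{k}{2}$, and with at most $\left(1+\frac{1}{18k}\right)n$ edges. Then $$r(G,P_k)=n+\lfloor k/2\rfloor-1.$$
   Context: All graphs are finite and simple. For graphs $H_1,H_2$, the Ramsey number $r(H_1,H_2)$ is the smallest positive integer $N$ such that every graph $\Gamma$ on $N$ vertices contains $H_1$ as a (not necessarily induced) subgraph or its complement $\overline{\Gamma}$ contains $H_2$ as a subgraph. $P_k$ is the path on $k$ vertices. For a vertex $v$ of $G$, $G_v$ is the subgraph of $G$ obtained by deleting $v$ and all neighbors of $v$. $\alpha'(G)$ is the minimum, over all vertices $v$ of $G$, of the independence number of $G_v$ (the empty graph has independence number $0$). *)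

theory Defs
  imports Complex_Main "Graph_Theory.Graph_Theory"
begin

text \<open>
  Finite simple graphs are \<^locale>\<open>pair_graph\<close>s: finite loop-free digraphs with a symmetric arc
  relation. An undirected edge \<open>{u, v}\<close> is represented by the two arcs \<open>(u, v)\<close> and \<open>(v, u)\<close>,
  so edges are counted as unordered pairs, while the degree of a vertex is its
  \<^const>\<open>out_degree\<close>.
\<close>

definition edges :: "('a, 'b) pre_digraph \<Rightarrow> 'a set set" where
  "edges G = {{u, v} | u v. u \<rightarrow>\<^bsub>G\<^esub> v}"

definition min_degree :: "('a, 'b) pre_digraph \<Rightarrow> nat" where
  "min_degree G = Min (out_degree G ` verts G)"

definition neighbors :: "('a, 'b) pre_digraph \<Rightarrow> 'a \<Rightarrow> 'a set" where
  "neighbors G v = {u \<in> verts G. v \<rightarrow>\<^bsub>G\<^esub> u}"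

definition independent_set :: "('a, 'b) pre_digraph \<Rightarrow> 'a set \<Rightarrow> bool" where
  "independent_set G S \<longleftrightarrow> S \<subseteq> verts G \<and> (\<forall>u\<in>S. \<forall>v\<in>S. \<not> u \<rightarrow>\<^bsub>G\<^esub> v)"

definition independence_number :: "('a, 'b) pre_digraph \<Rightarrow> nat" where
  "independence_number G = Max (card ` {S. independent_set G S})"

definition del_closed_nbhd :: "('a, 'b) pre_digraph \<Rightarrow> 'a \<Rightarrow> ('a, 'b) pre_digraph" where
  "del_closed_nbhd G v = G \<restriction> (verts G - ({v} \<union> neighbors G v))"

definition alpha' :: "('a, 'b) pre_digraph \<Rightarrow> nat" where
  "alpha' G = Min ((\<lambda>v. independence_number (del_closed_nbhd G v)) ` verts G)"

definition path_graph :: "nat \<Rightarrow> nat pair_pre_digraph" where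
  "path_graph k = \<lparr> pverts = {..<k},
     parcs = {(i, j). i < k \<and> j < k \<and> (j = Suc i \<or> i = Suc j)} \<rparr>"

definition complement_graph :: "'a pair_pre_digraph \<Rightarrow> 'a pair_pre_digraph" where
  "complement_graph G = \<lparr> pverts = pverts G,
     parcs = {(u, v). u \<in> pverts G \<and> v \<in> pverts G \<and> u \<noteq> v \<and> (u, v) \<notin> parcs G} \<rparr>"

text \<open>\<open>contains_copy G H\<close>: some not necessarily induced subgraph of \<open>G\<close> is isomorphic to \<open>H\<close>.\<close>

definition contains_copy :: "'a pair_pre_digraph \<Rightarrow> 'b pair_pre_digraph \<Rightarrow> bool" where
  "contains_copy G H \<longleftrightarrow>
     (\<exists>f. inj_on f (pverts H) \<and> f ` pverts H \<subseteq> pverts G \<and>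
          (\<forall>(u, v)\<in>parcs H. (f u, f v) \<in> parcs G))"

text \<open>
  The host graphs \<open>\<Gamma>\<close> have natural numbers as vertices; up to isomorphism this covers every
  finite host graph.
\<close>

definition ramsey_number :: "'a pair_pre_digraph \<Rightarrow> 'b pair_pre_digraph \<Rightarrow> nat" where
  "ramsey_number H1 H2 = (LEAST N. N > 0 \<and>
     (\<forall>\<Gamma> :: nat pair_pre_digraph. pair_graph \<Gamma> \<and> card (pverts \<Gamma>) = N \<longrightarrow>
        contains_copy \<Gamma> H1 \<or> contains_copy (complement_graph \<Gamma>) H2))"

lemma pair_graph_path_graph: "pair_graph (path_graph k)"
proof
  show "finite (parcs (path_graph k))"
    by (rule finite_subset[of _ "{..<k} \<times> {..<k}"]) (auto simp: path_graph_def)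
qed (auto simp: path_graph_def symmetric_def sym_def)

lemma pair_graph_complement_graph:
  assumes "pair_graph G"
  shows "pair_graph (complement_graph G)"
proof -
  interpret pair_graph G by fact
  show ?thesis
  proof
    show "finite (parcs (complement_graph G))"
      by (rule finite_subset[of _ "pverts G \<times> pverts G"]) (auto simp: complement_graph_def)
  qed (auto simp: complement_graph_def symmetric_def sym_def dest: arcs_symmetric)
qed

end

theory Submission
  imports Defs
begin

text \<open>
  Lower bound: let \<open>\<Gamma>\<close> be a complete graph on \<open>n - 1\<close> vertices plus isolated vertices. Its complement
  has a vertex cover of size less than \<open>k div 2\<close>, hence no \<open>P\<^sub>k\<close>.

  Upper bound: let \<open>\<Gamma>\<close> have \<open>n + k div 2 - 1\<close> vertices and a complement without \<open>P\<^sub>k\<close>. The key is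
  absorption: a path of \<open>\<Gamma>\<close> with at least \<open>2 * k + k div 2 - 2\<close> vertices, together with \<open>k div 2\<close>
  vertices outside, can be lengthened by one of these vertices with the same ends. Let \<open>c\<close> be the
  number of edges minus the number of vertices of \<open>G\<close>.

  If \<open>c > 0\<close>, then \<open>n \<ge> 18 * k * c\<close>. A long path of degree 2 vertices in \<open>G\<close> is shortened by contracting
  an edge; by induction the smaller graph embeds, and absorption yields an embedding of \<open>G\<close>. If no
  such path exists, \<open>G\<close> has at most \<open>15/2 * k * c\<close> vertices and embeds greedily, vertices of degree at
  least 3 first: at most a quarter of the vertices of \<open>\<Gamma>\<close> have degree at least \<open>4 * k\<close> in the complement.

  If \<open>c = 0\<close>, then \<open>G\<close> is a cycle. Depth-first search gives a long path of \<open>\<Gamma>\<close>, which closes to a cycle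
  of length at least \<open>n - 3 * (k div 2)\<close>. Absorption and a connectivity argument show that a longest
  cycle has length at least \<open>n\<close>, and a cycle is shortened by chords that skip one vertex.
\<close>

section \<open>Paths, cycles and degrees\<close>

definition is_path :: "('a \<Rightarrow> 'a \<Rightarrow> bool) \<Rightarrow> 'a set \<Rightarrow> 'a list \<Rightarrow> bool" where
  "is_path E S xs \<longleftrightarrow> distinct xs \<and> set xs \<subseteq> S \<and> successively E xs"

text \<open>For symmetric \<open>E\<close> an edge counts as a cycle of length 2. This is harmless,
  since the cycles finally used have at least \<open>3 * k\<close> vertices.\<close>

definition is_cycle :: "('a \<Rightarrow> 'a \<Rightarrow> bool) \<Rightarrow> 'a set \<Rightarrow> 'a list \<Rightarrow> bool" where
  "is_cycle E S xs \<longleftrightarrow> is_path E S xs \<and> xs \<noteq> [] \<and> E (last xs) (hd xs)"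

definition nbrs :: "('a \<Rightarrow> 'a \<Rightarrow> bool) \<Rightarrow> 'a set \<Rightarrow> 'a \<Rightarrow> 'a set" where
  "nbrs E S v = {u \<in> S. E v u}"

definition opp :: "('a \<Rightarrow> 'a \<Rightarrow> bool) \<Rightarrow> 'a \<Rightarrow> 'a \<Rightarrow> bool" where
  "opp E u v \<longleftrightarrow> u \<noteq> v \<and> \<not> E u v"

lemma finite_nbrs [simp]: "finite S \<Longrightarrow> finite (nbrs E S v)"
  by (simp add: nbrs_def)

lemma symp_opp: "symp E \<Longrightarrow> symp (opp E)"
  by (auto simp: symp_def opp_def)

lemma irreflp_opp: "irreflp (opp E)"
  by (auto simp: irreflp_def opp_def)

lemma is_path_rev:
  assumes "symp E" "is_path E S xs"
  shows "is_path E S (rev xs)"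
proof -
  have "(\<lambda>x y. E y x) = E"
    using assms(1) by (auto simp: symp_def fun_eq_iff)
  then have "successively (\<lambda>x y. E y x) xs = successively E xs"
    by (rule arg_cong)
  then show ?thesis
    using assms(2) by (simp add: is_path_def)
qed

lemma is_path_append:
  "is_path E S (xs @ ys) \<longleftrightarrow> is_path E S xs \<and> is_path E S ys \<and> set xs \<inter> set ys = {} \<and>
    (xs = [] \<or> ys = [] \<or> E (last xs) (hd ys))"
  by (auto simp: is_path_def successively_append_iff)

lemma is_path_take: "is_path E S xs \<Longrightarrow> is_path E S (take i xs)"
  by (metis append_take_drop_id is_path_append)

lemma is_path_drop: "is_path E S xs \<Longrightarrow> is_path E S (drop i xs)"
  by (metis append_take_drop_id is_path_append)

lemma is_path_length_le:
  assumes "finite S" "is_path E S xs"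
  shows "length xs \<le> card S"
  using assms card_mono[of S "set xs"] by (auto simp: is_path_def distinct_card)

lemma longest_path:
  assumes "finite S" "x \<in> S"
  obtains xs where "is_path E S xs" "xs \<noteq> []" "\<And>ys. is_path E S ys \<Longrightarrow> length ys \<le> length xs"
proof -
  have "is_path E S [x]" using assms by (simp add: is_path_def)
  moreover have "\<forall>ys. is_path E S ys \<longrightarrow> length ys < Suc (card S)"
    using is_path_length_le[OF assms(1)] by (simp add: less_Suc_eq_le)
  ultimately have "\<exists>xs. is_path E S xs \<and> (\<forall>ys. is_path E S ys \<longrightarrow> length ys \<le> length xs)"
    by (rule Lattices_Big.ex_has_greatest_nat)
  then obtain xs where xs: "is_path E S xs" "\<forall>ys. is_path E S ys \<longrightarrow> length ys \<le> length xs"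
    by (elim exE conjE)
  have "xs \<noteq> []" using xs(2) \<open>is_path E S [x]\<close> by fastforce
  then show thesis using that[OF xs(1)] xs(2) by simp
qed

lemma longest_path_hd:
  assumes "is_path E S xs" "\<And>ys. is_path E S ys \<Longrightarrow> length ys \<le> length xs"
    and "u \<in> S" "E u (hd xs)"
  shows "u \<in> set xs"
proof (rule ccontr)
  assume "u \<notin> set xs"
  then have "is_path E S (u # xs)"
    using assms by (auto simp: is_path_def successively_Cons)
  then show False using assms(2) by fastforce
qed

lemma longest_path_last:
  assumes "symp E" "is_path E S xs" "\<And>ys. is_path E S ys \<Longrightarrow> length ys \<le> length xs"
    and "u \<in> S" "E u (last xs)" "xs \<noteq> []"
  shows "u \<in> set xs"
  using longest_path_hd[of E S "rev xs" u] assms is_path_rev[OF assms(1,2)]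
  by (simp add: hd_rev)

lemma is_cycle_rotate:
  assumes "is_cycle E S xs"
  shows "is_cycle E S (rotate i xs)"
proof (induction i)
  case (Suc i)
  define ys where "ys = rotate i xs"
  have *: "is_cycle E S ys" using Suc ys_def by simp
  then obtain y zs where y: "ys = y # zs" by (cases ys) (auto simp: is_cycle_def)
  have "is_cycle E S (rotate1 ys)"
    using * unfolding y is_cycle_def is_path_def
    by (cases zs) (auto simp: successively_append_iff successively_Cons hd_append split: if_splits)
  then show ?case by (simp add: ys_def)
qed (use assms in simp)

section \<open>Degree sums and graphs without long paths\<close>

lemma sum_degree_insert:
  assumes "finite F" "x \<notin> F" "symp E" "irreflp E"
  shows "(\<Sum>v\<in>insert x F. card (nbrs E (insert x F) v)) =
    (\<Sum>v\<in>F. card (nbrs E F v)) + 2 * card (nbrs E F x)"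
proof -
  have 1: "nbrs E (insert x F) x = nbrs E F x"
    using assms(4) by (auto simp: nbrs_def irreflp_def)
  have 2: "card (nbrs E (insert x F) v) = card (nbrs E F v) + (if E v x then 1 else 0)" if "v \<in> F" for v
  proof (cases "E v x")
    case True
    then have "nbrs E (insert x F) v = insert x (nbrs E F v)" by (auto simp: nbrs_def)
    then show ?thesis using True assms by (simp add: nbrs_def)
  next
    case False
    then have "nbrs E (insert x F) v = nbrs E F v" by (auto simp: nbrs_def)
    then show ?thesis using False by simp
  qed
  have "(\<Sum>v\<in>F. if E v x then 1 else 0) = card {v\<in>F. E v x}"
    using assms(1) by (simp add: sum.If_cases Int_def)
  also have "{v\<in>F. E v x} = nbrs E F x"
    using assms(3) by (auto simp: nbrs_def symp_def)
  finally have 3: "(\<Sum>v\<in>F. if E v x then 1 else 0) = card (nbrs E F x)" .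
  show ?thesis using assms(1,2) by (simp add: 1 2 3 sum.distrib)
qed

lemma even_sum_degree:
  assumes "finite F" "symp E" "irreflp E"
  shows "even (\<Sum>v\<in>F. card (nbrs E F v))"
  using assms(1) by induction (use assms in \<open>simp_all add: sum_degree_insert del: sum.insert\<close>)

text \<open>By maximality all neighbors of both ends lie on \<open>xs\<close>. For some
  \<open>i\<close>, \<open>hd xs\<close> is adjacent to \<open>xs ! Suc i\<close> and
  \<open>last xs\<close> to \<open>xs ! i\<close>, which gives a cycle on the vertices of
  \<open>xs\<close>. A vertex outside with a neighbor on this cycle would start a longer
  path.\<close>

lemma longest_path_closed:
  assumes "finite S" "symp E" "irreflp E"
    and xs: "is_path E S xs" "xs \<noteq> []" "\<And>ys. is_path E S ys \<Longrightarrow> length ys \<le> length xs"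
    and deg: "length xs \<le> card (nbrs E S (hd xs)) + card (nbrs E S (last xs))"
    and "u \<in> S" "v \<in> set xs" "E u v"
  shows "u \<in> set xs"
proof (rule ccontr)
  assume u: "u \<notin> set xs"
  let ?p = "length xs"
  have dist: "distinct xs" using xs(1) by (simp add: is_path_def)
  have E_sym: "E a b \<longleftrightarrow> E b a" for a b using assms(2) by (auto simp: symp_def)
  \<comment> \<open>Neighbors of \<open>hd xs\<close> are indexed by their predecessors, so
    \<open>I\<close> and \<open>J\<close> both lie among \<open>?p - 1\<close> indices and must
    meet.\<close>
  define I where "I = {i. i < ?p - 1 \<and> E (hd xs) (xs ! Suc i)}"
  define J where "J = {i. i < ?p - 1 \<and> E (last xs) (xs ! i)}"
  have "nbrs E S (hd xs) \<subseteq> (\<lambda>i. xs ! Suc i) ` I"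
  proof
    fix w assume w: "w \<in> nbrs E S (hd xs)"
    then have "w \<in> set xs" using longest_path_hd[OF xs(1,3), of w] E_sym by (auto simp: nbrs_def)
    then obtain j where j: "j < ?p" "w = xs ! j" by (auto simp: in_set_conv_nth)
    have "w \<noteq> hd xs" using w assms(3) by (auto simp: nbrs_def irreflp_def)
    then have "j \<noteq> 0" using j xs(2) by (metis hd_conv_nth)
    then obtain i where "j = Suc i" by (cases j) auto
    then show "w \<in> (\<lambda>i. xs ! Suc i) ` I" using j w by (auto simp: I_def nbrs_def)
  qed
  then have cI: "card (nbrs E S (hd xs)) \<le> card I"
    using surj_card_le[of I] by (simp add: I_def)
  have "nbrs E S (last xs) \<subseteq> (\<lambda>i. xs ! i) ` J"
  proof
    fix w assume w: "w \<in> nbrs E S (last xs)"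
    then have "w \<in> set xs" using longest_path_last[OF assms(2) xs(1,3), of w] E_sym xs(2) by (auto simp: nbrs_def)
    then obtain j where j: "j < ?p" "w = xs ! j" by (auto simp: in_set_conv_nth)
    have "w \<noteq> last xs" using w assms(3) by (auto simp: nbrs_def irreflp_def)
    then have "j \<noteq> ?p - 1" using j xs(2) by (auto simp: last_conv_nth)
    then show "w \<in> (\<lambda>i. xs ! i) ` J" using j w by (auto simp: J_def nbrs_def)
  qed
  then have cJ: "card (nbrs E S (last xs)) \<le> card J"
    using surj_card_le[of J] by (simp add: J_def)
  have fin: "finite I" "finite J" by (auto simp: I_def J_def)
  have "I \<inter> J \<noteq> {}"
  proof
    assume "I \<inter> J = {}"
    then have "card I + card J = card (I \<union> J)" using fin by (simp add: card_Un_disjoint)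
    also have "\<dots> \<le> card {..<?p - 1}" by (rule card_mono) (auto simp: I_def J_def)
    finally show False using cI cJ deg xs(2) by (cases xs) auto
  qed
  then obtain i where i: "i < ?p - 1" "E (hd xs) (xs ! Suc i)" "E (last xs) (xs ! i)"
    by (auto simp: I_def J_def)
  have e: "E (xs ! Suc i) (hd xs)" "E (xs ! i) (last xs)" using i E_sym by blast+
  define cs where "cs = take (Suc i) xs @ rev (drop (Suc i) xs)"
  have set_cs: "set cs = set xs"
    unfolding cs_def set_append set_rev by (metis append_take_drop_id set_append)
  have ne: "take (Suc i) xs \<noteq> []" "drop (Suc i) xs \<noteq> []" using i by auto
  have "is_path E S (take (Suc i) xs)" "is_path E S (rev (drop (Suc i) xs))"
    using xs(1) assms(2) is_path_rev is_path_drop is_path_take by blast+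
  moreover have "last (take (Suc i) xs) = xs ! i" using i by (simp add: take_Suc_conv_app_nth)
  moreover have "hd (rev (drop (Suc i) xs)) = last xs" using i by (simp add: hd_rev)
  moreover have "hd (drop (Suc i) xs) = xs ! Suc i" using i by (simp add: hd_drop_conv_nth)
  moreover have "distinct cs"
    using dist unfolding cs_def by (metis append_take_drop_id distinct_append distinct_rev set_rev)
  ultimately have "is_cycle E S cs"
    using i(3) e ne by (simp add: cs_def is_cycle_def is_path_def successively_append_iff last_rev)
  moreover obtain j where j: "j < length cs" "v = cs ! j"
    using assms(9) set_cs by (metis in_set_conv_nth)
  ultimately have c: "is_cycle E S (rotate j cs)" "hd (rotate j cs) = v"
    using is_cycle_rotate by (auto simp: hd_rotate_conv_nth simp flip: length_greater_0_conv)
  then have "is_path E S (u # rotate j cs)"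
    using u set_cs assms(8,10) by (auto simp: is_cycle_def is_path_def successively_Cons)
  from xs(3)[OF this] show False by (simp add: cs_def)
qed

text \<open>The Erdos-Gallai theorem, as a bound on the degree sum. If the ends of a longest path
  have large degree sum, its vertices form a component with fewer than \<open>k\<close> vertices, so
  their degrees are at most \<open>k - 2\<close>. Otherwise one end has degree at most half of
  \<open>k - 2\<close>, and deleting it lowers the degree sum by at most
  \<open>k - 2\<close>.\<close>

lemma sum_degree_path_free:
  assumes "finite S" "symp E" "irreflp E"
    and "\<And>xs. is_path E S xs \<Longrightarrow> length xs < k"
  shows "(\<Sum>v\<in>S. card (nbrs E S v)) \<le> (k - 2) * card S"
  using assms(1,4)
proof (induction S rule: finite_psubset_induct)
  case (psubset S)
  have sub: "is_path E T xs \<Longrightarrow> T \<subseteq> S \<Longrightarrow> is_path E S xs" for T xs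
    by (auto simp: is_path_def)
  show ?case
  proof (cases "S = {}")
    case False
    then obtain x where "x \<in> S" by auto
    then obtain xs where xs: "is_path E S xs" "xs \<noteq> []" "\<And>ys. is_path E S ys \<Longrightarrow> length ys \<le> length xs"
      using longest_path psubset(1) by metis
    have len: "length xs \<le> k - 1" using psubset(3)[OF xs(1)] by simp
    show ?thesis
    proof (cases "length xs \<le> card (nbrs E S (hd xs)) + card (nbrs E S (last xs))")
      case True
      let ?P = "set xs" and ?R = "S - set xs"
      have PS: "?P \<subseteq> S" and dist: "distinct xs" using xs(1) by (auto simp: is_path_def)
      have closed: "u \<in> ?P" if "u \<in> S" "v \<in> ?P" "E u v" for u v
        using longest_path_closed[OF psubset(1) assms(2,3) xs True that] .
      have "?R \<subset> S" using PS xs(2) by (cases xs) auto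
      then have "(\<Sum>v\<in>?R. card (nbrs E ?R v)) \<le> (k - 2) * card ?R"
        using psubset.IH psubset.prems sub by blast
      moreover have "(\<Sum>v\<in>?R. card (nbrs E S v)) = (\<Sum>v\<in>?R. card (nbrs E ?R v))"
      proof (rule sum.cong)
        fix v assume "v \<in> ?R"
        then have "nbrs E S v = nbrs E ?R v" using closed by (auto simp: nbrs_def)
        then show "card (nbrs E S v) = card (nbrs E ?R v)" by simp
      qed simp
      moreover have "(\<Sum>v\<in>?P. card (nbrs E S v)) \<le> card ?P * (k - 2)"
      proof -
        have "card (nbrs E S v) \<le> k - 2" if "v \<in> ?P" for v
        proof -
          have "nbrs E S v \<subseteq> ?P - {v}"
            using closed that assms(2,3) by (auto simp: nbrs_def symp_def irreflp_def)
          then have "card (nbrs E S v) \<le> card (?P - {v})" by (intro card_mono) auto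
          also have "\<dots> \<le> k - 2" using that len dist by (simp add: distinct_card)
          finally show ?thesis .
        qed
        then show ?thesis using sum_bounded_above[of ?P "\<lambda>v. card (nbrs E S v)" "k - 2"] by simp
      qed
      moreover have "(\<Sum>v\<in>S. card (nbrs E S v)) = (\<Sum>v\<in>?R. card (nbrs E S v)) + (\<Sum>v\<in>?P. card (nbrs E S v))"
        using PS psubset(1) sum.subset_diff by blast
      moreover have "card S = card ?R + card ?P"
        using PS psubset(1) by (metis List.finite_set card_Diff_subset card_mono le_add_diff_inverse2)
      ultimately show ?thesis by (simp add: algebra_simps)
    next
      case False
      then have small: "card (nbrs E S (hd xs)) + card (nbrs E S (last xs)) \<le> k - 2"
        using len by simp
      obtain x where x: "x \<in> S" "2 * card (nbrs E S x) \<le> k - 2"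
      proof (cases "card (nbrs E S (hd xs)) \<le> card (nbrs E S (last xs))")
        case True
        moreover have "hd xs \<in> S" using xs(1,2) hd_in_set by (auto simp: is_path_def)
        ultimately show thesis using that[of "hd xs"] small by linarith
      next
        case False
        moreover have "last xs \<in> S" using xs(1,2) last_in_set by (auto simp: is_path_def)
        ultimately show thesis using that[of "last xs"] small by linarith
      qed
      let ?F = "S - {x}"
      have S: "S = insert x ?F" using x by auto
      have "?F \<subset> S" using x by auto
      then have IH: "(\<Sum>v\<in>?F. card (nbrs E ?F v)) \<le> (k - 2) * card ?F"
        using psubset.IH psubset.prems sub by blast
      have "(\<Sum>v\<in>S. card (nbrs E S v)) = (\<Sum>v\<in>?F. card (nbrs E ?F v)) + 2 * card (nbrs E ?F x)"
        using sum_degree_insert[of ?F x E] psubset(1) assms(2,3) S by simp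
      also have "card (nbrs E ?F x) \<le> card (nbrs E S x)"
        using psubset(1) by (intro card_mono) (auto simp: nbrs_def)
      finally have "(\<Sum>v\<in>S. card (nbrs E S v)) \<le> (k - 2) * card ?F + (k - 2)"
        using IH x by linarith
      also have "\<dots> = (k - 2) * card S"
        using card_Suc_Diff1[OF psubset(1) x(1)] by (metis mult_Suc_right add.commute)
      finally show ?thesis .
    qed
  qed simp
qed

section \<open>Absorbing a vertex into a path\<close>

text \<open>The path is built from its far end; \<open>y0\<close> is the vertex of \<open>A\<close>
  that can be put in front next. Whenever a common neighbor of \<open>y0\<close> and
  \<open>y\<close> is needed, at most \<open>t\<close> vertices of \<open>X\<close> are in use, so a
  fresh one exists.\<close>

lemma alternating_path:
  assumes E: "symp E" "finite X" "A \<inter> X = {}"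
    and common: "\<And>y y'. y \<in> A \<Longrightarrow> y' \<in> A \<Longrightarrow> t < card (nbrs E X y \<inter> nbrs E X y')"
    and "distinct ys" "set ys \<subseteq> A" "length ys \<le> t" "y0 \<in> A"
  shows "\<exists>p. p \<noteq> [] \<and> is_path E (A \<union> X) p \<and> length p = 2 * length ys + 1 \<and> hd p \<in> nbrs E X y0 \<and>
    set p \<inter> A \<subseteq> set ys \<and> card (set p \<inter> X) \<le> length ys + 1"
  using assms(5-)
proof (induction ys arbitrary: y0)
  case Nil
  have "nbrs E X y0 \<noteq> {}" using common[of y0 y0] Nil by auto
  then obtain x where "x \<in> nbrs E X y0" by auto
  then show ?case
    using E(3) by (intro exI[of _ "[x]"]) (auto simp: is_path_def nbrs_def)
next
  case (Cons y ys)
  have "distinct ys" "set ys \<subseteq> A" "length ys \<le> t" "y \<in> A" using Cons.prems by auto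
  from Cons.IH[OF this] obtain p where p: "p \<noteq> []" "is_path E (A \<union> X) p" "length p = 2 * length ys + 1"
    "hd p \<in> nbrs E X y" "set p \<inter> A \<subseteq> set ys" "card (set p \<inter> X) \<le> length ys + 1"
    by (elim exE conjE)
  have "t < card (nbrs E X y0 \<inter> nbrs E X y)" using common Cons by simp
  moreover have "card (set p \<inter> X) \<le> t" using p Cons by simp
  ultimately have "\<not> nbrs E X y0 \<inter> nbrs E X y \<subseteq> set p \<inter> X"
    by (meson List.finite_set card_mono finite_Int leD le_trans)
  then obtain x where x: "x \<in> nbrs E X y0" "x \<in> nbrs E X y" "x \<notin> set p"
    by (auto simp: nbrs_def)
  have y: "y \<in> A" "y \<notin> set p" using p(5) Cons.prems by auto
  have "E x y" using x(2) E(1) by (auto simp: nbrs_def symp_def)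
  moreover have "x \<in> X" "x \<noteq> y" using x(1) y E(3) by (auto simp: nbrs_def)
  ultimately have "is_path E (A \<union> X) (x # y # p)"
    using p x y by (auto simp: is_path_def successively_Cons nbrs_def)
  moreover have "set (x # y # p) \<inter> X = insert x (set p \<inter> X)"
    using \<open>x \<in> X\<close> y E(3) by auto
  then have "card (set (x # y # p) \<inter> X) \<le> length (y # ys) + 1"
    using p(6) x(3) by simp
  moreover have "set (x # y # p) \<inter> A \<subseteq> set (y # ys)"
    using p(5) \<open>x \<in> X\<close> E(3) by auto
  ultimately show ?case
    using p(3) x(1) by (intro exI[of _ "x # y # p"]) auto
qed

section \<open>Host graphs whose complement has no path on \<open>k\<close> vertices\<close>

locale path_free_complement =
  fixes V :: "'b set" and r :: "'b \<Rightarrow> 'b \<Rightarrow> bool" and k :: nat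
  assumes finite_V: "finite V" and symp_r: "symp r" and irreflp_r: "irreflp r"
    and k_ge_2: "2 \<le> k"
    and no_path: "\<And>xs. is_path (opp r) V xs \<Longrightarrow> length xs < k"
begin

lemma r_sym: "r u v \<Longrightarrow> r v u"
  using symp_r by (auto simp: symp_def)

lemma finite_sub: "S \<subseteq> V \<Longrightarrow> finite S"
  using finite_V finite_subset by blast

text \<open>Such a set is a clique of the complement, so any enumeration of it is a path
  there.\<close>

lemma independent_card:
  assumes "K \<subseteq> V" "\<And>u v. u \<in> K \<Longrightarrow> v \<in> K \<Longrightarrow> u \<noteq> v \<Longrightarrow> \<not> r u v"
  shows "card K < k"
proof -
  obtain xs where xs: "set xs = K" "distinct xs"
    using finite_distinct_list finite_sub assms(1) by metis
  have "successively (opp r) xs"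
    unfolding successively_conv_nth opp_def
    using xs assms(2) by (auto simp: nth_eq_iff_index_eq)
  then show ?thesis using no_path[of xs] xs assms(1) by (simp add: is_path_def distinct_card[symmetric])
qed

text \<open>An alternating path of the complement through \<open>k div 2\<close> vertices of
  \<open>A\<close> would have \<open>2 * (k div 2) + 1\<close> vertices, which is at least
  \<open>k\<close>.\<close>

lemma few_common_non_nbrs:
  assumes "A \<subseteq> V" "X \<subseteq> V" "A \<inter> X = {}" "k div 2 \<le> card A"
    and common: "\<And>y y'. y \<in> A \<Longrightarrow> y' \<in> A \<Longrightarrow> k div 2 < card (nbrs (opp r) X y \<inter> nbrs (opp r) X y')"
  shows False
proof -
  obtain A' where A': "A' \<subseteq> A" "card A' = k div 2" "finite A'"
    using obtain_subset_with_card_n[OF assms(4)] by metis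
  then obtain ys where ys: "set ys = A'" "distinct ys" using finite_distinct_list by metis
  then have len: "length ys = k div 2" using A' distinct_card by metis
  have "A \<noteq> {}" using assms(4) k_ge_2 by auto
  then obtain y0 where "y0 \<in> A" by auto
  then obtain p where "is_path (opp r) (A \<union> X) p" "length p = 2 * length ys + 1"
    using alternating_path[of "opp r" X A "k div 2" ys y0] symp_opp[OF symp_r] finite_sub assms A' ys len
    by auto
  moreover from this have "is_path (opp r) V p" using assms(1,2) by (auto simp: is_path_def)
  ultimately show False using no_path[of p] len by linarith
qed

lemma no_large_gap:
  assumes "A \<subseteq> V" "X \<subseteq> V" "A \<inter> X = {}" "k div 2 \<le> card A" "k div 2 < card X"
  shows "\<exists>a\<in>A. \<exists>x\<in>X. r a x"
proof (rule ccontr)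
  assume *: "\<not> (\<exists>a\<in>A. \<exists>x\<in>X. r a x)"
  have "nbrs (opp r) X y = X" if "y \<in> A" for y
    using that * assms(3) by (auto simp: nbrs_def opp_def)
  then show False using few_common_non_nbrs[OF assms(1-4)] assms(5) by simp
qed

text \<open>
  If no \<open>y \<in> Y\<close> can be absorbed, then the successors on \<open>zs\<close> of the neighbors of \<open>y\<close>, together
  with \<open>y\<close>, are pairwise nonadjacent: an edge between two successors would allow to reverse the
  segment between them. So \<open>y\<close> has at most \<open>k - 2\<close> neighbors on \<open>zs\<close>, apart from the last vertex.
\<close>

lemma absorb_vertex:
  assumes zs: "is_path r V zs" "2 * k + k div 2 \<le> length zs + 2"
    and Y: "Y \<subseteq> V" "Y \<inter> set zs = {}" "k div 2 \<le> card Y"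
  shows "\<exists>y\<in>Y. \<exists>zs'. is_path r V zs' \<and> set zs' = insert y (set zs) \<and> hd zs' = hd zs \<and> last zs' = last zs"
proof (rule ccontr)
  assume "\<not> ?thesis"
  then have no: False if "y \<in> Y" "is_path r V zs'" "set zs' = insert y (set zs)" "hd zs' = hd zs" "last zs' = last zs"
    for y zs' using that by blast
  let ?m = "length zs"
  \<comment> \<open>The last index is left out, because the last vertex of \<open>zs\<close> has no
    successor.\<close>
  define R where "R y = {i. Suc i < ?m \<and> r y (zs ! i)}" for y
  have fin_R: "finite (R y)" for y
    unfolding R_def by (rule finite_subset[of _ "{..<?m}"]) auto
  have dist: "distinct zs" and zsV: "set zs \<subseteq> V" using zs(1) by (auto simp: is_path_def)
  have insert: "\<not> r y (zs ! Suc i)" if "y \<in> Y" "i \<in> R y" for y i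
  proof
    assume *: "r y (zs ! Suc i)"
    let ?A = "take (Suc i) zs" and ?C = "drop (Suc i) zs"
    have i: "Suc i < ?m" "r y (zs ! i)" using that(2) by (auto simp: R_def)
    have ne: "?A \<noteq> []" "?C \<noteq> []" using i by auto
    have "is_path r V (?A @ ?C)" using zs(1) by simp
    moreover have "last ?A = zs ! i" using i by (simp add: take_Suc_conv_app_nth)
    moreover have "hd ?C = zs ! Suc i" using i by (simp add: hd_drop_conv_nth)
    moreover have AC: "set ?A \<union> set ?C = set zs" by (metis append_take_drop_id set_append)
    moreover have "y \<in> V" "y \<notin> set zs" using that(1) Y by auto
    ultimately have "is_path r V (?A @ [y] @ ?C)"
      using i * ne r_sym unfolding is_path_append by (auto simp: is_path_def)
    moreover have "set (?A @ [y] @ ?C) = insert y (set zs)" using AC by auto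
    moreover have "hd (?A @ [y] @ ?C) = hd zs" using ne by (simp add: hd_append)
    moreover have "last (?A @ [y] @ ?C) = last zs" using ne by simp
    ultimately show False using no that(1) by blast
  qed
  have cross: "\<not> r (zs ! Suc i) (zs ! Suc j)" if "y \<in> Y" "i \<in> R y" "j \<in> R y" "i < j" for y i j
  proof
    assume *: "r (zs ! Suc i) (zs ! Suc j)"
    let ?A = "take (Suc i) zs" and ?B = "drop (Suc i) (take (Suc j) zs)" and ?C = "drop (Suc j) zs"
    have i: "Suc i < ?m" "r y (zs ! i)" and j: "Suc j < ?m" "r y (zs ! j)"
      using that by (auto simp: R_def)
    have ne: "?A \<noteq> []" "?B \<noteq> []" "?C \<noteq> []" using i j that(4) by auto
    have eq: "zs = ?A @ ?B @ ?C"
      using that(4) by (metis append.assoc append_take_drop_id less_imp_le_nat min.absorb1 take_take Suc_le_mono)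
    have "hd ?B = take (Suc j) zs ! Suc i"
      using j that(4) by (intro hd_drop_conv_nth) simp
    then have "hd ?B = zs ! Suc i" using that(4) by simp
    moreover have "last ?A = zs ! i" "last ?B = zs ! j" "hd ?C = zs ! Suc j"
      using i j that(4) by (auto simp: take_Suc_conv_app_nth hd_drop_conv_nth)
    ultimately have ends: "last ?A = zs ! i" "hd ?B = zs ! Suc i" "last ?B = zs ! j" "hd ?C = zs ! Suc j"
      by blast+
    have parts: "is_path r V ?A" "is_path r V ?B" "is_path r V ?C"
      using zs(1) is_path_take is_path_drop by blast+
    have sets: "set ?A \<inter> set ?B = {}" "set ?A \<inter> set ?C = {}" "set ?B \<inter> set ?C = {}"
      "set zs = set ?A \<union> set ?B \<union> set ?C"
    proof -
      have "distinct (?A @ ?B @ ?C)" "set zs = set (?A @ ?B @ ?C)" using dist eq by metis+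
      then show "set ?A \<inter> set ?B = {}" "set ?A \<inter> set ?C = {}" "set ?B \<inter> set ?C = {}"
        "set zs = set ?A \<union> set ?B \<union> set ?C"
        by (simp_all only: distinct_append set_append Int_Un_distrib Un_empty Un_assoc)
    qed
    have y: "y \<in> V" "y \<notin> set zs" using that(1) Y by auto
    let ?zs = "?A @ [y] @ rev ?B @ ?C"
    have "is_path r V (rev ?B)" using is_path_rev[OF symp_r] parts by blast
    moreover have "is_path r V [y]" using y by (simp add: is_path_def)
    moreover have "hd (rev ?B @ ?C) = zs ! j" "hd ([y] @ rev ?B @ ?C) = y" "last (rev ?B) = zs ! Suc i"
      using ends ne by (auto simp: hd_append hd_rev last_rev)
    ultimately have "is_path r V ?zs"
      unfolding is_path_append using parts sets y ends i(2) j(2) * r_sym[of y "zs ! i"] by auto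
    moreover have "set ?zs = insert y (set zs)" using sets(4) by auto
    moreover have "hd ?zs = hd zs" using ne by (simp add: hd_append)
    moreover have "last ?zs = last zs" using ne by simp
    ultimately show False using no that(1) by blast
  qed
  have card_R: "card (R y) \<le> k - 2" if y: "y \<in> Y" for y
  proof -
    let ?K = "(\<lambda>i. zs ! Suc i) ` R y"
    have sub: "?K \<subseteq> set zs" by (auto simp: R_def)
    have "card ?K = card (R y)"
      by (rule card_image) (use dist in \<open>auto simp: inj_on_def R_def nth_eq_iff_index_eq\<close>)
    moreover have "y \<notin> ?K" using sub y Y by auto
    moreover have "card (insert y ?K) < k"
    proof (rule independent_card)
      show "insert y ?K \<subseteq> V" using sub y Y zsV by auto
    next
      fix u v assume uv: "u \<in> insert y ?K" "v \<in> insert y ?K" "u \<noteq> v"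
      show "\<not> r u v"
      proof (cases "u = y \<or> v = y")
        case True
        then show ?thesis using uv insert[OF y] r_sym by blast
      next
        case False
        then obtain i j where "u = zs ! Suc i" "v = zs ! Suc j" "i \<in> R y" "j \<in> R y" using uv by auto
        then show ?thesis using cross[OF y, of i j] cross[OF y, of j i] uv(3) r_sym
          by (cases i j rule: linorder_cases) blast+
      qed
    qed
    ultimately show ?thesis using fin_R by simp
  qed
  \<comment> \<open>Of the \<open>?m - 1\<close> vertices in \<open>?X\<close>, two vertices of
    \<open>Y\<close> together miss all but at most \<open>2 * (k - 2)\<close>. This leaves at least
    \<open>?m - 2 * k + 3\<close> common non-neighbors, and the assumed length of \<open>zs\<close>
    makes that at least \<open>k div 2 + 1\<close>.\<close>
  let ?X = "(!) zs ` {..<?m - 1}"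
  have XV: "?X \<subseteq> set zs" by auto
  have "inj_on ((!) zs) {..<?m - 1}" using dist by (auto simp: inj_on_def nth_eq_iff_index_eq)
  then have cX: "card ?X = ?m - 1" by (simp add: card_image)
  have non: "nbrs (opp r) ?X y = ?X - (!) zs ` R y" if "y \<in> Y" for y
  proof -
    have "y \<notin> ?X" using that Y XV by blast
    moreover have "\<not> r y (zs ! i) \<longleftrightarrow> zs ! i \<notin> (!) zs ` R y" if "i < ?m - 1" for i
      using that dist by (auto simp: R_def nth_eq_iff_index_eq image_iff)
    ultimately show ?thesis
      by (auto simp: nbrs_def opp_def)
  qed
  show False
  proof (rule few_common_non_nbrs[OF Y(1) _ _ Y(3)])
    show "?X \<subseteq> V" using zsV XV by blast
    show "Y \<inter> ?X = {}" using Y XV by blast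
    fix y y' assume y: "y \<in> Y" "y' \<in> Y"
    let ?B = "(!) zs ` R y \<union> (!) zs ` R y'"
    have "card ?B \<le> card (R y) + card (R y')"
      using card_Un_le card_image_le[OF fin_R] by (meson add_mono le_trans)
    then have "card ?B \<le> 2 * (k - 2)" using card_R[OF y(1)] card_R[OF y(2)] by linarith
    moreover have "card ?X - card ?B \<le> card (?X - ?B)"
      using fin_R by (intro diff_card_le_card_Diff) auto
    moreover have "nbrs (opp r) ?X y \<inter> nbrs (opp r) ?X y' = ?X - ?B"
      using non y by auto
    ultimately show "k div 2 < card (nbrs (opp r) ?X y \<inter> nbrs (opp r) ?X y')"
      using cX zs(2) k_ge_2 by simp
  qed
qed

end

section \<open>Cycles of prescribed length\<close>

text \<open>\<open>F\<close> holds the finished vertices, \<open>P\<close> is the stack with its top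
  at the head, \<open>U\<close> is the unvisited part and \<open>n\<close> counts moves. A vertex
  goes from \<open>U\<close> to \<open>P\<close> and later to \<open>F\<close>, so \<open>n\<close>
  is twice \<open>card F\<close> plus the length of \<open>P\<close>; this is the last equation. A
  vertex is finished only when it has no neighbor left in \<open>U\<close>.\<close>

lemma depth_first_search:
  assumes "finite S" "n \<le> card S"
  shows "\<exists>F P U. S = F \<union> set P \<union> U \<and> F \<inter> set P = {} \<and> F \<inter> U = {} \<and> set P \<inter> U = {} \<and>
    is_path E S P \<and> (\<forall>f\<in>F. \<forall>u\<in>U. \<not> E u f) \<and> card U + n = card F + card S"
  using assms(2)
proof (induction n)
  case 0
  show ?case by (intro exI[of _ "{}"] exI[of _ "[]"] exI[of _ S]) (simp add: is_path_def)
next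
  case (Suc n)
  then obtain F P U where IH: "S = F \<union> set P \<union> U" "F \<inter> set P = {}" "F \<inter> U = {}" "set P \<inter> U = {}"
    "is_path E S P" "\<forall>f\<in>F. \<forall>u\<in>U. \<not> E u f" "card U + n = card F + card S"
    by auto
  have fin: "finite F" "finite U" using IH(1) assms(1) by auto
  \<comment> \<open>Since \<open>Suc n \<le> card S\<close>, the equation makes
    \<open>card U\<close> larger than \<open>card F\<close>.\<close>
  have "U \<noteq> {}" using IH(7) Suc.prems by auto
  then obtain u where u: "u \<in> U" by auto
  have push: ?case if u: "u \<in> U" and "P = [] \<or> E u (hd P)" for u
  proof (intro exI conjI)
    show "S = F \<union> set (u # P) \<union> (U - {u})" "F \<inter> set (u # P) = {}" "F \<inter> (U - {u}) = {}"
      "set (u # P) \<inter> (U - {u}) = {}" "\<forall>f\<in>F. \<forall>u\<in>U - {u}. \<not> E u f"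
      using IH u by auto
    show "is_path E S (u # P)" using IH that by (auto simp: is_path_def successively_Cons)
    show "card (U - {u}) + Suc n = card F + card S"
      using IH(7) card_Suc_Diff1[OF fin(2) u] by linarith
  qed
  show ?case
  proof (cases "P = [] \<or> (\<exists>u\<in>U. E u (hd P))")
    case True
    then show ?thesis using push u by blast
  next
    case False
    then obtain p P' where P: "P = p # P'" by (cases P) auto
    show ?thesis
    proof (intro exI conjI)
      show "S = insert p F \<union> set P' \<union> U" "insert p F \<inter> set P' = {}" "insert p F \<inter> U = {}"
        "set P' \<inter> U = {}" "is_path E S P'"
        using IH P by (auto simp: is_path_def successively_Cons)
      show "\<forall>f\<in>insert p F. \<forall>u\<in>U. \<not> E u f" using IH False P by auto
      have "p \<notin> F" using IH(2) P by auto
      then show "card U + Suc n = card (insert p F) + card S" using IH(7) fin by simp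
    qed
  qed
qed

lemma path_of_rtranclp:
  assumes "(\<lambda>u v. u \<in> Y \<and> v \<in> Y \<and> E u v)\<^sup>*\<^sup>* u v" "u \<in> Y"
  shows "\<exists>p. p \<noteq> [] \<and> is_path E Y p \<and> hd p = u \<and> last p = v"
  using assms(1)
proof induction
  case base
  show ?case using assms(2) by (intro exI[of _ "[u]"]) (simp add: is_path_def)
next
  case (step v w)
  then obtain p where p: "p \<noteq> []" "is_path E Y p" "hd p = u" "last p = v" by auto
  show ?case
  proof (cases "w \<in> set p")
    case True
    then obtain a b where ab: "p = a @ w # b" by (auto dest: split_list)
    then have "is_path E Y ((a @ [w]) @ b)" using p by simp
    then have "is_path E Y (a @ [w])" using is_path_append by blast
    then show ?thesis using p ab by (intro exI[of _ "a @ [w]"]) (auto simp: hd_append)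
  next
    case False
    then have "is_path E Y (p @ [w])"
      using p step by (auto simp: is_path_append is_path_def[of E Y "[w]"])
    then show ?thesis using p by (intro exI[of _ "p @ [w]"]) auto
  qed
qed

lemma length_le_twice_filter:
  assumes "successively (\<lambda>x y. P x \<or> P y) xs" "xs \<noteq> [] \<Longrightarrow> P (hd xs)"
  shows "length xs \<le> 2 * length (filter P xs)"
  using assms
proof (induction xs rule: induct_list012)
  case (3 x y xs)
  show ?case
  proof (cases "P y")
    case True
    then show ?thesis using 3 by simp
  next
    case False
    then have "length xs \<le> 2 * length (filter P xs)"
      using 3 by (cases xs) (auto simp: successively_Cons)
    then show ?thesis using 3 by simp
  qed
qed auto

context path_free_complement
begin

text \<open>After \<open>card V\<close> moves of the search, as many vertices are finished as
  unvisited. No edge joins the two sets, so each has at most \<open>k div 2\<close> vertices; the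
  stack is the required path.\<close>

lemma exists_long_path:
  obtains P where "is_path r V P" "card V \<le> length P + 2 * (k div 2)"
proof -
  obtain F P U where *: "V = F \<union> set P \<union> U" "F \<inter> set P = {}" "F \<inter> U = {}" "set P \<inter> U = {}"
    "is_path r V P" "\<forall>f\<in>F. \<forall>u\<in>U. \<not> r u f" "card U + card V = card F + card V"
    using depth_first_search[OF finite_V order.refl, of r] by auto
  have fin: "finite F" "finite U" using *(1) finite_V by auto
  have "card F \<le> k div 2"
  proof (rule ccontr)
    assume "\<not> card F \<le> k div 2"
    then have "\<exists>a\<in>U. \<exists>x\<in>F. r a x"
      using * by (intro no_large_gap) auto
    then show False using *(6) by auto
  qed
  moreover have "card V = card F + card (set P) + card U"
    using * fin by (simp add: card_Un_disjoint Int_Un_distrib2)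
  moreover have "card (set P) = length P" using *(5) by (simp add: is_path_def distinct_card)
  ultimately show thesis using that *(5,7) by simp
qed

text \<open>Some edge joins the first \<open>k div 2\<close> vertices of a long path to its last
  \<open>k div 2 + 1\<close> vertices. It closes a cycle that misses at most
  \<open>2 * (k div 2) - 1\<close> vertices of the path.\<close>

lemma exists_long_cycle:
  assumes "4 * (k div 2) < card V"
  obtains cs where "is_cycle r V cs" "card V < length cs + 4 * (k div 2)"
proof -
  let ?t = "k div 2"
  obtain P where P: "is_path r V P" "card V \<le> length P + 2 * ?t"
    by (rule exists_long_path)
  let ?p = "length P"
  let ?A = "take ?t P" and ?X = "drop (?p - Suc ?t) P"
  have dist: "distinct P" "set P \<subseteq> V" using P by (auto simp: is_path_def)
  have p: "2 * ?t < ?p" using P(2) assms by linarith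
  have "\<exists>a\<in>set ?A. \<exists>x\<in>set ?X. r a x"
  proof (rule no_large_gap)
    show "set ?A \<subseteq> V" "set ?X \<subseteq> V" using dist set_take_subset set_drop_subset by fast+
    show "set ?A \<inter> set ?X = {}" using dist p by (intro set_take_disj_set_drop_if_distinct) auto
    have "card (set ?A) = length ?A" "card (set ?X) = length ?X"
      using dist by (simp_all add: distinct_card del: length_take length_drop)
    then show "?t \<le> card (set ?A)" "?t < card (set ?X)" using p by auto
  qed
  then obtain a x where ax: "a \<in> set ?A" "x \<in> set ?X" "r a x" by auto
  from ax(1) obtain i where i: "i < ?t" "i < ?p" "a = P ! i" by (auto simp: in_set_conv_nth)
  from ax(2) obtain j' where "j' < length ?X" "x = ?X ! j'" by (metis in_set_conv_nth)
  then obtain j where j: "j < ?p" "?p \<le> j + Suc ?t" "x = P ! j"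
    using p by (intro that[of "?p - Suc ?t + j'"]) auto
  let ?cs = "drop i (take (Suc j) P)"
  have ij: "i < j" using i j p by linarith
  have len: "length ?cs = Suc j - i" using j by simp
  then have ne: "?cs \<noteq> []" using ij by auto
  have "is_path r V ?cs" using P is_path_take is_path_drop by blast
  moreover have "hd ?cs = a" using i j ij by (simp add: hd_drop_conv_nth)
  moreover have "last ?cs = x" using j ij by (simp add: last_conv_nth)
  ultimately have "is_cycle r V ?cs" using ne ax r_sym by (simp add: is_cycle_def)
  moreover have "card V < length ?cs + 4 * ?t" using len i j P(2) by linarith
  ultimately show thesis by (rule that)
qed

text \<open>The \<open>k\<close> vertices at positions \<open>0, 2, ..., 2 * k - 2\<close> do not
  form a path of the complement. So two consecutive ones are adjacent in \<open>r\<close>, and the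
  vertex between them can be skipped.\<close>

lemma cycle_shrink:
  assumes cs: "is_cycle r V cs" "2 * k \<le> length cs"
  shows "\<exists>cs'. is_cycle r V cs' \<and> Suc (length cs') = length cs"
proof -
  have path: "is_path r V cs" and dist: "distinct cs" and csV: "set cs \<subseteq> V"
    using cs by (auto simp: is_cycle_def is_path_def)
  let ?xs = "map (\<lambda>i. cs ! (2 * i)) [0..<k]"
  have "\<exists>i. Suc i < k \<and> r (cs ! (2 * i)) (cs ! (2 * i + 2))"
  proof (rule ccontr)
    assume *: "\<not> ?thesis"
    have "successively (opp r) ?xs"
      using * dist cs(2) by (auto simp: successively_conv_nth opp_def nth_eq_iff_index_eq)
    moreover have "distinct ?xs"
      using dist cs(2) by (auto simp: distinct_map inj_on_def nth_eq_iff_index_eq)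
    moreover have "set ?xs \<subseteq> V" using csV cs(2) by (auto intro!: subsetD[OF csV] nth_mem)
    ultimately show False using no_path[of ?xs] by (simp add: is_path_def)
  qed
  then obtain i where i: "Suc i < k" "r (cs ! (2 * i)) (cs ! (2 * i + 2))" by auto
  define j where "j = 2 * i"
  have j: "j + 2 < length cs" "r (cs ! j) (cs ! (j + 2))" using i cs(2) by (auto simp: j_def)
  let ?A = "take (Suc j) cs" and ?C = "drop (j + 2) cs"
  have ne: "?A \<noteq> []" "?C \<noteq> []" using j by auto
  have "is_path r V ?A" "is_path r V ?C" using path is_path_take is_path_drop by blast+
  moreover have "set ?A \<inter> set ?C = {}" using dist by (intro set_take_disj_set_drop_if_distinct) auto
  moreover have "last ?A = cs ! j" using j by (simp add: take_Suc_conv_app_nth)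
  moreover have "hd ?C = cs ! (j + 2)" using j by (intro hd_drop_conv_nth) simp
  ultimately have "is_path r V (?A @ ?C)" using j by (simp add: is_path_append)
  moreover have "hd (?A @ ?C) = hd cs" "last (?A @ ?C) = last cs" using ne by (auto simp: hd_append)
  ultimately have "is_cycle r V (?A @ ?C)" using cs ne by (simp add: is_cycle_def)
  then show ?thesis using j by (intro exI[of _ "?A @ ?C"]) simp
qed

lemma cycle_shrink_to:
  assumes "is_cycle r V cs" "2 * k \<le> n" "n \<le> length cs"
  shows "\<exists>cs'. is_cycle r V cs' \<and> length cs' = n"
  using assms
proof (induction "length cs - n" arbitrary: cs)
  case (Suc d)
  obtain cs' where "is_cycle r V cs'" "Suc (length cs') = length cs"
    using cycle_shrink[of cs] Suc.prems by auto
  then show ?case using Suc.hyps(1)[of cs'] Suc.hyps(2) Suc.prems by simp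
qed auto

text \<open>
  Take a longest path \<open>xs\<close> of the complement inside \<open>Y\<close> and a component \<open>D\<close> of \<open>Y\<close> meeting \<open>Y - set xs\<close>.
  Vertices inside and outside \<open>D\<close> are adjacent in the complement, so by maximality \<open>xs\<close> starts in \<open>D\<close>,
  has no two consecutive vertices outside \<open>D\<close>, and covers \<open>Y - D\<close>.
\<close>

lemma exists_large_connected:
  assumes Y: "Y \<subseteq> V" "k \<le> card Y"
  obtains D where "D \<subseteq> Y" "k div 2 \<le> card D"
    "\<And>u v. u \<in> D \<Longrightarrow> v \<in> D \<Longrightarrow> \<exists>p. p \<noteq> [] \<and> is_path r Y p \<and> hd p = u \<and> last p = v"
proof -
  have finY: "finite Y" using Y finite_sub by blast
  have "Y \<noteq> {}" using Y k_ge_2 by auto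
  then obtain y where "y \<in> Y" by auto
  then obtain xs where xs: "is_path (opp r) Y xs" "xs \<noteq> []"
    and longest: "\<And>ys. is_path (opp r) Y ys \<Longrightarrow> length ys \<le> length xs"
    using longest_path[OF finY, of y "opp r"] by blast
  have "is_path (opp r) V xs" using xs Y by (auto simp: is_path_def)
  then have len: "length xs < k" by (rule no_path)
  have xsY: "set xs \<subseteq> Y" and dist: "distinct xs" using xs by (auto simp: is_path_def)
  have "card (set xs) < card Y" using len Y(2) dist by (simp add: distinct_card)
  then obtain z where z: "z \<in> Y" "z \<notin> set xs"
    by (metis List.finite_set card_mono leD subsetI)
  define R where "R = (\<lambda>u v. u \<in> Y \<and> v \<in> Y \<and> r u v)"
  have symR: "R\<^sup>*\<^sup>* v u" if "R\<^sup>*\<^sup>* u v" for u v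
    using that
  proof induction
    case (step v w)
    then have "R w v" using r_sym by (auto simp: R_def)
    then show ?case using step.IH by (rule converse_rtranclp_into_rtranclp)
  qed simp
  define D where "D = {y \<in> Y. R\<^sup>*\<^sup>* z y}"
  have zD: "z \<in> D" using z by (simp add: D_def)
  have sep: "opp r d y" "opp r y d" if "d \<in> D" "y \<in> Y" "y \<notin> D" for d y
  proof -
    have "\<not> r d y" using that rtranclp.rtrancl_into_rtrancl[of R z d y] by (auto simp: D_def R_def)
    then show "opp r d y" "opp r y d" using that r_sym by (auto simp: opp_def)
  qed
  have hd: "hd xs \<in> D"
  proof (rule ccontr)
    assume "hd xs \<notin> D"
    moreover have "hd xs \<in> Y" using xs(2) xsY by auto
    ultimately have "opp r z (hd xs)" using sep zD by blast
    then show False using longest_path_hd[OF xs(1) longest] z by blast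
  qed
  have rest: "Y - set xs \<subseteq> D"
  proof
    fix y assume y: "y \<in> Y - set xs"
    show "y \<in> D"
    proof (rule ccontr)
      assume "y \<notin> D"
      then have "opp r y (hd xs)" using sep hd y by blast
      then show False using longest_path_hd[OF xs(1) longest] y by blast
    qed
  qed
  have "successively (\<lambda>x y. x \<in> D \<or> y \<in> D) xs"
    unfolding successively_conv_nth
  proof (intro allI impI)
    fix i assume i: "Suc i < length xs"
    show "xs ! i \<in> D \<or> xs ! Suc i \<in> D"
    proof (rule ccontr)
      assume "\<not> ?thesis"
      then have opp: "opp r (xs ! i) z" "opp r z (xs ! Suc i)"
        using sep[OF zD] i xsY by (auto simp: subset_iff)
      let ?A = "take (Suc i) xs" and ?C = "drop (Suc i) xs"
      have "is_path (opp r) Y (?A @ ?C)" using xs by simp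
      moreover have "last ?A = xs ! i" using i by (simp add: take_Suc_conv_app_nth)
      moreover have "hd ?C = xs ! Suc i" using i by (simp add: hd_drop_conv_nth)
      moreover have "set ?A \<union> set ?C = set xs" by (metis append_take_drop_id set_append)
      moreover have "is_path (opp r) Y [z]" using z by (simp add: is_path_def)
      ultimately have "is_path (opp r) Y (?A @ [z] @ ?C)"
        using opp z(2) i unfolding is_path_append by auto
      from longest[OF this] show False using i by simp
    qed
  qed
  \<comment> \<open>At least half of \<open>xs\<close> and all of \<open>Y - set xs\<close> lie in
    \<open>D\<close>. So \<open>card D\<close> is at least \<open>card Y\<close> minus half the
    length of \<open>xs\<close>, where \<open>card Y \<ge> k > length xs\<close>.\<close>
  then have "length xs \<le> 2 * length (filter (\<lambda>x. x \<in> D) xs)"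
    using hd by (intro length_le_twice_filter)
  moreover have "length (filter (\<lambda>x. x \<in> D) xs) = card (D \<inter> set xs)"
    using dist by (metis Int_commute distinct_card distinct_filter set_filter inter_set_filter)
  moreover have finD: "finite D" using finY by (simp add: D_def)
  then have "card D = card (D \<inter> set xs) + card (D - set xs)"
    by (metis card_Int_Diff)
  moreover have "card (Y - set xs) \<le> card (D - set xs)"
    using rest finD by (intro card_mono) auto
  moreover have "card (Y - set xs) = card Y - length xs"
    using xsY dist finY by (simp add: card_Diff_subset distinct_card)
  ultimately have card_D: "k div 2 \<le> card D" using Y(2) len by linarith
  show thesis
  proof (rule that[of D])
    show "D \<subseteq> Y" by (auto simp: D_def)
    show "k div 2 \<le> card D" by (fact card_D)
    fix u v assume uv: "u \<in> D" "v \<in> D"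
    then have "R\<^sup>*\<^sup>* u v" using symR[of z u] by (auto simp: D_def)
    then show "\<exists>p. p \<noteq> [] \<and> is_path r Y p \<and> hd p = u \<and> last p = v"
      unfolding R_def using uv(1) by (intro path_of_rtranclp) (auto simp: D_def)
  qed
qed

text \<open>
  The vertices outside a longest cycle contain a large connected set \<open>D\<close>. Two consecutive vertices of
  the cycle cannot both have neighbors in \<open>D\<close>, so at least half of the cycle is not joined to \<open>D\<close>.
\<close>

lemma exists_cycle_of_length:
  assumes n: "3 * k \<le> n" "n + k div 2 \<le> card V + 1"
  obtains cs where "is_cycle r V cs" "length cs = n"
proof -
  let ?t = "k div 2"
  have "4 * ?t < card V" using n k_ge_2 by linarith
  then obtain cs0 where cs0: "is_cycle r V cs0" "card V < length cs0 + 4 * ?t"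
    by (rule exists_long_cycle)
  note cs0(1)
  moreover have "\<forall>cs. is_cycle r V cs \<longrightarrow> length cs < Suc (card V)"
    using is_path_length_le[OF finite_V] by (auto simp: is_cycle_def less_Suc_eq_le)
  ultimately have "\<exists>cs. is_cycle r V cs \<and> (\<forall>cs'. is_cycle r V cs' \<longrightarrow> length cs' \<le> length cs)"
    by (rule Lattices_Big.ex_has_greatest_nat)
  then obtain cs where cs: "is_cycle r V cs" and longest: "\<And>cs'. is_cycle r V cs' \<Longrightarrow> length cs' \<le> length cs"
    by auto
  let ?m = "length cs"
  \<comment> \<open>\<open>length cs0\<close> is at least \<open>n - 3 * ?t\<close>, and
    \<open>n \<ge> 3 * k \<ge> 6 * ?t\<close>.\<close>
  have m: "3 * ?t \<le> ?m" using longest[OF cs0(1)] cs0(2) n by linarith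
  have path: "is_path r V cs" and dist: "distinct cs" and csV: "set cs \<subseteq> V" and ne: "cs \<noteq> []"
    using cs by (auto simp: is_cycle_def is_path_def)
  have "n \<le> ?m"
  proof (rule ccontr)
    assume mn: "\<not> n \<le> ?m"
    let ?Y = "V - set cs"
    have card_Y: "card ?Y = card V - ?m"
      using csV dist by (simp add: card_Diff_subset distinct_card)
    \<comment> \<open>A cycle of this length could absorb an outside vertex: absorption keeps the
      ends, so the new path still closes up. As \<open>cs\<close> is therefore short, at least
      \<open>k\<close> vertices lie outside it.\<close>
    have not_long: "\<not> 2 * k + ?t \<le> ?m + 2"
    proof
      assume "2 * k + ?t \<le> ?m + 2"
      moreover have "?t \<le> card ?Y" using card_Y mn n(2) by linarith
      ultimately obtain y zs where y: "y \<in> ?Y" "is_path r V zs" "set zs = insert y (set cs)" "hd zs = hd cs" "last zs = last cs"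
        using absorb_vertex[OF path, of ?Y] by blast
      then have "is_cycle r V zs" using cs by (auto simp: is_cycle_def)
      then have "length zs \<le> ?m" by (rule longest)
      moreover have "length zs = Suc ?m"
        using y dist by (metis DiffD2 List.finite_set card_insert_disjoint distinct_card is_path_def)
      ultimately show False by simp
    qed
    then have "k \<le> card ?Y" using card_Y n by linarith
    then obtain D where D: "D \<subseteq> ?Y" "?t \<le> card D"
      "\<And>u v. u \<in> D \<Longrightarrow> v \<in> D \<Longrightarrow> \<exists>p. p \<noteq> [] \<and> is_path r ?Y p \<and> hd p = u \<and> last p = v"
      using exists_large_connected[of ?Y] by blast
    define S where "S = {i. i < ?m \<and> (\<exists>d\<in>D. r (cs ! i) d)}"
    have next_free: "Suc i mod ?m \<notin> S" if iS: "i \<in> S" for i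
    proof
      assume "Suc i mod ?m \<in> S"
      then obtain d' where d': "d' \<in> D" "r (cs ! (Suc i mod ?m)) d'" by (auto simp: S_def)
      obtain d where d: "d \<in> D" "r (cs ! i) d" "i < ?m" using iS by (auto simp: S_def)
      obtain p where p: "p \<noteq> []" "is_path r ?Y p" "hd p = d" "last p = d'" using D(3) d d' by blast
      \<comment> \<open>The rotation puts position \<open>i\<close> last and its successor first, so
        that \<open>p\<close> can replace the closing edge.\<close>
      let ?R = "rotate (Suc i) cs"
      have R: "is_cycle r V ?R" using cs by (rule is_cycle_rotate)
      have hdR: "hd ?R = cs ! (Suc i mod ?m)" using ne by (rule hd_rotate_conv_nth)
      have "Suc i + (?m - 1) = i + ?m" using d(3) by linarith
      then have "(Suc i + (?m - 1)) mod ?m = i" using d(3) by simp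
      moreover have "?R ! (?m - 1) = cs ! ((Suc i + (?m - 1)) mod ?m)"
        using d(3) by (intro nth_rotate) simp
      ultimately have lastR: "last ?R = cs ! i"
        using ne by (simp add: last_conv_nth del: rotate_Suc)
      have "is_path r V (?R @ p)"
        unfolding is_path_append using R p d lastR by (auto simp: is_cycle_def is_path_def)
      then have "is_cycle r V (?R @ p)"
        using R p d' hdR r_sym by (auto simp: is_cycle_def)
      from longest[OF this] show False using p(1) by simp
    qed
    have fin: "finite S" by (simp add: S_def)
    have Sm: "S \<subseteq> {..<?m}" by (auto simp: S_def)
    \<comment> \<open>Moving to the next position maps \<open>S\<close> injectively into its
      complement. Hence at least half of the cycle has no neighbor in \<open>D\<close>, which by
      \<open>3 * ?t \<le> ?m\<close> is more than \<open>?t\<close> vertices.\<close>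
    have "card S \<le> card ({..<?m} - S)"
    proof (rule card_inj_on_le[of "\<lambda>i. Suc i mod ?m"])
      show "inj_on (\<lambda>i. Suc i mod ?m) S"
      proof (rule inj_onI)
        fix i j assume "i \<in> S" "j \<in> S" "Suc i mod ?m = Suc j mod ?m"
        moreover from this have "i mod ?m = i" "j mod ?m = j" using Sm by auto
        ultimately show "i = j" by (simp add: mod_Suc split: if_splits)
      qed
      show "(\<lambda>i. Suc i mod ?m) ` S \<subseteq> {..<?m} - S" using next_free ne by auto
    qed simp
    moreover have "card ({..<?m} - S) = ?m - card S" using Sm fin by (simp add: card_Diff_subset)
    moreover let ?X = "(!) cs ` ({..<?m} - S)"
    have "card ?X = card ({..<?m} - S)"
      by (rule card_image) (use dist in \<open>auto simp: inj_on_def nth_eq_iff_index_eq\<close>)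
    ultimately have "?m \<le> 2 * card ?X" by linarith
    moreover have "0 < ?t" using k_ge_2 by simp
    ultimately have "?t < card ?X" using m by linarith
    then have "\<exists>a\<in>D. \<exists>x\<in>?X. r a x"
      using D csV by (intro no_large_gap) auto
    then show False using r_sym by (auto simp: S_def)
  qed
  then show thesis using cycle_shrink_to[OF cs _ \<open>n \<le> ?m\<close>] n that k_ge_2 by auto
qed

end

section \<open>Sparse connected graphs of minimum degree 2\<close>

lemma nth_interior_nbrs:
  assumes "symp E" "is_path E W xs" "0 < i" "Suc i < length xs" "card (nbrs E W (xs ! i)) = 2"
  shows "nbrs E W (xs ! i) = {xs ! (i - 1), xs ! Suc i}"
proof -
  have d: "distinct xs" "set xs \<subseteq> W" and succ: "successively E xs"
    using assms(2) by (auto simp: is_path_def)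
  have "E (xs ! j) (xs ! Suc j)" if "Suc j < length xs" for j
    using succ that unfolding successively_conv_nth by blast
  from this[of "i - 1"] this[of i] have "E (xs ! i) (xs ! (i - 1))" "E (xs ! i) (xs ! Suc i)"
    using assms(1,3,4) by (auto simp: symp_def)
  moreover have "xs ! (i - 1) \<in> W" "xs ! Suc i \<in> W"
    using assms(3,4) subsetD[OF d(2) nth_mem] by auto
  ultimately have "{xs ! (i - 1), xs ! Suc i} \<subseteq> nbrs E W (xs ! i)"
    by (auto simp: nbrs_def)
  moreover have "xs ! (i - 1) \<noteq> xs ! Suc i"
    using d assms(3,4) by (simp add: nth_eq_iff_index_eq)
  then have "card {xs ! (i - 1), xs ! Suc i} = 2" by simp
  \<comment> \<open>An infinite set has \<open>card\<close> 0, so cardinality 2 implies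
    finiteness.\<close>
  moreover have "finite (nbrs E W (xs ! i))" using assms(5) card.infinite by fastforce
  ultimately show ?thesis using assms(5) card_subset_eq by metis
qed

lemma sum_card_nbrs_swap:
  assumes "finite A" "finite B" "symp E"
  shows "(\<Sum>v\<in>A. card (nbrs E B v)) = (\<Sum>u\<in>B. card (nbrs E A u))"
proof -
  have "card (nbrs E S u) = (\<Sum>v\<in>S. if E u v then 1 else 0)" if "finite S" for S u
    using that by (simp add: sum.If_cases nbrs_def Int_def)
  moreover have "E u v \<longleftrightarrow> E v u" for u v using assms(3) by (auto simp: symp_def)
  ultimately show ?thesis
    using assms(1,2) sum.swap[of "\<lambda>u v. if E u v then 1 else (0::nat)" B A] by simp
qed

text \<open>
  By the degree condition, \<open>c\<close> is the number of edges minus the number of vertices. The condition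
  \<open>boundary\<close> is connectedness.
\<close>

locale min_degree_2_graph =
  fixes W :: "'a set" and adj :: "'a \<Rightarrow> 'a \<Rightarrow> bool" and c :: nat
  assumes finite_W: "finite W" and symp_adj: "symp adj" and irreflp_adj: "irreflp adj"
    and degree_ge_2: "\<And>v. v \<in> W \<Longrightarrow> 2 \<le> card (nbrs adj W v)"
    and degree_excess: "(\<Sum>v\<in>W. card (nbrs adj W v) - 2) = 2 * c"
    and boundary: "\<And>S. S \<subseteq> W \<Longrightarrow> S \<noteq> {} \<Longrightarrow> S \<noteq> W \<Longrightarrow> \<exists>u\<in>S. \<exists>v\<in>W - S. adj u v"
begin

definition thin :: "'a set" where
  "thin = {v \<in> W. card (nbrs adj W v) = 2}"

definition branch :: "'a set" where
  "branch = {v \<in> W. card (nbrs adj W v) \<noteq> 2}"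

lemma W_split: "W = branch \<union> thin" "branch \<inter> thin = {}" "thin \<subseteq> W" "branch \<subseteq> W"
  by (auto simp: thin_def branch_def)

lemma finite_thin: "finite thin" and finite_branch: "finite branch"
  using finite_W W_split finite_subset by blast+

lemma adj_sym: "adj u v \<Longrightarrow> adj v u"
  using symp_adj by (auto simp: symp_def)

lemma adj_nth_interior:
  assumes "is_path adj W xs" "0 < i" "Suc i < length xs" "xs ! i \<in> thin" "u \<in> W" "adj (xs ! i) u"
  shows "u = xs ! (i - 1) \<or> u = xs ! Suc i"
proof -
  have "u \<in> nbrs adj W (xs ! i)" using assms by (simp add: nbrs_def)
  then show ?thesis
    using nth_interior_nbrs[OF symp_adj assms(1-3)] assms(4) by (auto simp: thin_def)
qed

text \<open>An interior vertex has degree 2, so both its edges lie on the path. At an end, a further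
  neighbor in \<open>S\<close> would extend the path.\<close>

lemma longest_thin_path_closed:
  assumes S: "S \<subseteq> thin" "\<And>v u. v \<in> S \<Longrightarrow> u \<in> thin \<Longrightarrow> adj v u \<Longrightarrow> u \<in> S"
    and xs: "is_path adj S xs" "xs \<noteq> []" "\<And>ys. is_path adj S ys \<Longrightarrow> length ys \<le> length xs"
    and "v \<in> set xs" "u \<in> thin" "adj v u"
  shows "u \<in> set xs"
proof -
  have xsS: "set xs \<subseteq> S" using xs(1) by (simp add: is_path_def)
  have uS: "u \<in> S" using S(2) assms(6-8) xsS by blast
  obtain i where i: "i < length xs" "v = xs ! i" using assms(6) by (auto simp: in_set_conv_nth)
  consider "i = 0" | "i = length xs - 1" | "0 < i" "Suc i < length xs" using i by linarith
  then show ?thesis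
  proof cases
    case 1
    then have "adj u (hd xs)" using i adj_sym[OF assms(8)] xs(2) by (simp add: hd_conv_nth)
    then show ?thesis using longest_path_hd[OF xs(1,3) uS] by simp
  next
    case 2
    then have "adj u (last xs)" using i adj_sym[OF assms(8)] xs(2) by (simp add: last_conv_nth)
    then show ?thesis using longest_path_last[OF symp_adj xs(1,3) uS _ xs(2)] by simp
  next
    case 3
    have "is_path adj W xs" using xs(1) S(1) W_split(3) by (auto simp: is_path_def)
    moreover have "v \<in> thin" "u \<in> W" using assms(6,7) xsS S(1) W_split(3) by auto
    ultimately have "u = xs ! (i - 1) \<or> u = xs ! Suc i"
      using adj_nth_interior[of xs i u] 3 i(2) assms(8) by simp
    then show ?thesis using 3 by auto
  qed
qed

text \<open>
  The set \<open>S\<close> is a union of components of the subgraph induced by \<open>thin\<close>. Each of them is a path, and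
  it sends a positive and even number of edges to \<open>branch\<close>.
\<close>

lemma card_thin_part_le:
  assumes "branch \<noteq> {}" and short: "\<And>xs. is_path adj thin xs \<Longrightarrow> length xs \<le> m"
    and "S \<subseteq> thin" "\<And>v u. v \<in> S \<Longrightarrow> u \<in> thin \<Longrightarrow> adj v u \<Longrightarrow> u \<in> S"
  shows "2 * card S \<le> m * (\<Sum>v\<in>S. card (nbrs adj branch v))"
proof -
  have "finite S" using assms(3) finite_thin finite_subset by blast
  then show ?thesis using assms(3,4)
  proof (induction S rule: finite_psubset_induct)
    case (psubset S)
    show ?case
    proof (cases "S = {}")
      case False
      then obtain x where "x \<in> S" by auto
      then obtain xs where xs: "is_path adj S xs" "xs \<noteq> []"
        and longest: "\<And>ys. is_path adj S ys \<Longrightarrow> length ys \<le> length xs"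
        using longest_path[OF psubset(1), of x adj] by blast
      let ?P = "set xs"
      have PS: "?P \<subseteq> S" and dist: "distinct xs" using xs by (auto simp: is_path_def)
      have closed: "u \<in> ?P" if "v \<in> ?P" "u \<in> thin" "adj v u" for u v
        by (rule longest_thin_path_closed[OF psubset.prems(1) psubset.prems(2) xs longest that])
      have card_P: "card ?P \<le> m"
        using short[of xs] xs psubset.prems(1) dist by (auto simp: is_path_def distinct_card)
      have P_W: "?P \<subseteq> W" "?P \<noteq> {}" "?P \<noteq> W"
        using PS psubset.prems(1) W_split assms(1) xs(2) by auto
      then obtain u v where uv: "u \<in> ?P" "v \<in> W - ?P" "adj u v" using boundary[OF P_W] by blast
      then have "v \<in> branch" using closed[of u v] W_split(1) by auto
      then have "nbrs adj branch u \<noteq> {}" using uv by (auto simp: nbrs_def)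
      then have pos: "0 < (\<Sum>v\<in>?P. card (nbrs adj branch v))"
        using uv(1) finite_branch by (intro sum_pos2[of _ u]) (auto simp: card_gt_0_iff)
      have "card (nbrs adj ?P v) + card (nbrs adj branch v) = 2" if "v \<in> ?P" for v
      proof -
        have "nbrs adj W v = nbrs adj ?P v \<union> nbrs adj branch v"
          using closed[OF that] P_W(1) W_split(1) by (auto simp: nbrs_def)
        moreover have "nbrs adj ?P v \<inter> nbrs adj branch v = {}"
          using PS psubset.prems(1) W_split(2) by (auto simp: nbrs_def)
        moreover have "card (nbrs adj W v) = 2"
          using that PS psubset.prems(1) by (auto simp: thin_def)
        ultimately show ?thesis using finite_branch by (metis List.finite_set card_Un_disjoint finite_nbrs)
      qed
      then have "(\<Sum>v\<in>?P. card (nbrs adj ?P v)) + (\<Sum>v\<in>?P. card (nbrs adj branch v)) = 2 * card ?P"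
        by (simp flip: sum.distrib)
      moreover have "even (\<Sum>v\<in>?P. card (nbrs adj ?P v))"
        using even_sum_degree symp_adj irreflp_adj by blast
      ultimately have "even (\<Sum>v\<in>?P. card (nbrs adj branch v))"
        by (metis dvd_triv_left even_add)
      with pos have "2 \<le> (\<Sum>v\<in>?P. card (nbrs adj branch v))"
        using dvd_imp_le by blast
      then have "card ?P * 2 \<le> m * (\<Sum>v\<in>?P. card (nbrs adj branch v))"
        by (rule mult_le_mono[OF card_P])
      then have 1: "2 * card ?P \<le> m * (\<Sum>v\<in>?P. card (nbrs adj branch v))"
        by (simp only: mult.commute[of 2])
      have 2: "2 * card (S - ?P) \<le> m * (\<Sum>v\<in>S - ?P. card (nbrs adj branch v))"
      proof (rule psubset.IH)
        show "S - ?P \<subset> S" using PS xs(2) by (cases xs) auto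
        show "S - ?P \<subseteq> thin" using psubset.prems(1) by auto
        fix v u assume vu: "v \<in> S - ?P" "u \<in> thin" "adj v u"
        then have "u \<in> S" using psubset.prems(2)[of v u] by simp
        moreover have "v \<in> thin" using vu(1) psubset.prems(1) by auto
        then have "u \<notin> ?P" using closed[of u v] adj_sym[OF vu(3)] vu(1) by auto
        ultimately show "u \<in> S - ?P" by simp
      qed
      have "card S = card (S - ?P) + card ?P"
        using PS psubset(1) by (metis List.finite_set card_Diff_subset card_mono le_add_diff_inverse2)
      moreover have "(\<Sum>v\<in>S. card (nbrs adj branch v)) =
          (\<Sum>v\<in>S - ?P. card (nbrs adj branch v)) + (\<Sum>v\<in>?P. card (nbrs adj branch v))"
        using PS psubset(1) sum.subset_diff by blast
      ultimately show ?thesis using 1 2 by (simp add: distrib_left)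
    qed simp
  qed
qed

lemma sum_excess_branch: "(\<Sum>v\<in>branch. card (nbrs adj W v) - 2) = 2 * c"
proof -
  have "(\<Sum>v\<in>branch. card (nbrs adj W v) - 2) = (\<Sum>v\<in>W. card (nbrs adj W v) - 2)"
    using finite_W W_split(4) by (rule sum.mono_neutral_left) (auto simp: branch_def)
  then show ?thesis using degree_excess by simp
qed

text \<open>Each vertex of \<open>branch\<close> contributes at least 1 to the total excess
  \<open>2 * c\<close>.\<close>

lemma card_branch_le: "card branch \<le> 2 * c"
proof -
  have "(\<Sum>v\<in>branch. 1) \<le> (\<Sum>v\<in>branch. card (nbrs adj W v) - 2)"
  proof (rule sum_mono)
    fix v assume "v \<in> branch"
    then have "2 \<le> card (nbrs adj W v)" "card (nbrs adj W v) \<noteq> 2"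
      using degree_ge_2[of v] by (auto simp: branch_def)
    then show "1 \<le> card (nbrs adj W v) - 2" by linarith
  qed
  then show ?thesis using sum_excess_branch by simp
qed

lemma branch_nonempty: "0 < c \<Longrightarrow> branch \<noteq> {}"
  using sum_excess_branch by auto

text \<open>The degrees in \<open>branch\<close> sum to \<open>2 * c + 2 * card branch\<close>, so
  at most \<open>6 * c\<close> edges join \<open>branch\<close> to \<open>thin\<close>. Each
  component of \<open>thin\<close> has at most \<open>m\<close> vertices and takes at least two of
  these edges.\<close>

lemma card_thin_le:
  assumes "0 < c" "\<And>xs. is_path adj thin xs \<Longrightarrow> length xs \<le> m"
  shows "card thin \<le> 3 * c * m"
proof -
  have "(\<Sum>v\<in>thin. card (nbrs adj branch v)) = (\<Sum>v\<in>branch. card (nbrs adj thin v))"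
    using sum_card_nbrs_swap finite_thin finite_branch symp_adj by blast
  also have "\<dots> \<le> (\<Sum>v\<in>branch. (card (nbrs adj W v) - 2) + 2)"
  proof (rule sum_mono)
    fix v
    have "card (nbrs adj thin v) \<le> card (nbrs adj W v)"
      using finite_W W_split(3) by (intro card_mono) (auto simp: nbrs_def)
    then show "card (nbrs adj thin v) \<le> (card (nbrs adj W v) - 2) + 2" by simp
  qed
  also have "\<dots> = 2 * c + card branch * 2"
    by (simp only: sum.distrib sum_excess_branch sum_constant of_nat_id)
  also have "\<dots> \<le> 6 * c" using card_branch_le by simp
  finally have "m * (\<Sum>v\<in>thin. card (nbrs adj branch v)) \<le> m * (6 * c)" by simp
  moreover have "2 * card thin \<le> m * (\<Sum>v\<in>thin. card (nbrs adj branch v))"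
    using card_thin_part_le[OF branch_nonempty[OF assms(1)] assms(2), of thin] by blast
  ultimately have "2 * card thin \<le> m * (6 * c)" by (rule le_trans[rotated])
  also have "\<dots> = 2 * (3 * c * m)" by simp
  finally show ?thesis by simp
qed

text \<open>All degrees are 2, so the vertex set of a longest path is closed under adjacency and, by
  connectedness, is all of \<open>W\<close>. Only the possible edges are restricted, which suffices
  to map the graph into a cycle.\<close>

lemma hamiltonian_ordering:
  assumes "c = 0" "W \<noteq> {}"
  obtains xs where "distinct xs" "set xs = W"
    "\<And>i j. i < j \<Longrightarrow> j < length xs \<Longrightarrow> adj (xs ! i) (xs ! j) \<Longrightarrow> j = Suc i \<or> i = 0 \<and> j = length xs - 1"
proof -
  have "branch = {}" using card_branch_le assms(1) finite_branch by simp
  then have thin: "thin = W" using W_split by simp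
  obtain x where "x \<in> W" using assms(2) by auto
  then obtain xs where xs: "is_path adj W xs" "xs \<noteq> []"
    and longest: "\<And>ys. is_path adj W ys \<Longrightarrow> length ys \<le> length xs"
    using longest_path[OF finite_W, of x adj] by blast
  have xsW: "set xs \<subseteq> W" and dist: "distinct xs" using xs(1) by (auto simp: is_path_def)
  have "u \<in> set xs" if "v \<in> set xs" "u \<in> W" "adj v u" for u v
    using longest_thin_path_closed[of W xs v u] xs longest that thin by blast
  then have set: "set xs = W" using boundary[of "set xs"] xsW xs(2) by blast
  have "j = Suc i \<or> i = 0 \<and> j = length xs - 1"
    if ij: "i < j" "j < length xs" "adj (xs ! i) (xs ! j)" for i j
  proof (cases "0 < i")
    case True
    have "xs ! i \<in> thin" "xs ! j \<in> W" using nth_mem[of i xs] nth_mem[of j xs] ij set thin by simp_all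
    then have "xs ! j = xs ! (i - 1) \<or> xs ! j = xs ! Suc i"
      using adj_nth_interior[OF xs(1) True] ij by simp
    then show ?thesis using dist ij by (auto simp: nth_eq_iff_index_eq)
  next
    case i0: False
    show ?thesis
    proof (cases "Suc j < length xs")
      case True
      have "xs ! j \<in> thin" "xs ! i \<in> W" using nth_mem[of i xs] nth_mem[of j xs] ij set thin by simp_all
      then have "xs ! i = xs ! (j - 1) \<or> xs ! i = xs ! Suc j"
        using adj_nth_interior[OF xs(1) _ True] ij(1,2) adj_sym[OF ij(3)] by simp
      then show ?thesis using dist ij True by (auto simp: nth_eq_iff_index_eq)
    next
      case False
      then show ?thesis using i0 ij by auto
    qed
  qed
  then show thesis using that dist set by blast
qed

end

section \<open>Contraction inside a path of degree 2 vertices\<close>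

definition contract :: "('a \<Rightarrow> 'a \<Rightarrow> bool) \<Rightarrow> 'a \<Rightarrow> 'a \<Rightarrow> 'a \<Rightarrow> 'a \<Rightarrow> 'a \<Rightarrow> bool" where
  "contract adj a x b u v \<longleftrightarrow>
    u \<noteq> x \<and> v \<noteq> x \<and> (adj u v \<or> u = a \<and> v = b \<or> u = b \<and> v = a)"

context min_degree_2_graph
begin

text \<open>The contraction deletes \<open>x\<close> and joins \<open>a\<close> to \<open>b\<close>.
  The other neighbor of \<open>b\<close> is \<open>d\<close>, so \<open>a\<close> and
  \<open>b\<close> were not adjacent before. Hence all remaining degrees are unchanged, and
  \<open>c\<close> is too because \<open>x\<close> has degree 2.\<close>

lemma contract_graph:
  assumes path: "is_path adj thin (a # x # b # d # ps)"
  shows "min_degree_2_graph (W - {x}) (contract adj a x b) c"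
    and "is_path (contract adj a x b) (W - {x}) (a # b # d # ps)"
proof -
  let ?xs = "a # x # b # d # ps" and ?E = "contract adj a x b" and ?W = "W - {x}"
  have pathW: "is_path adj W ?xs" using path W_split(3) by (auto simp: is_path_def)
  have dist: "distinct ?xs" and inW: "a \<in> W" "x \<in> W" "b \<in> W" "set ps \<subseteq> W" "d \<in> W"
    and succ: "successively adj ?xs"
    using pathW by (auto simp: is_path_def)
  have thin: "x \<in> thin" "b \<in> thin" using path by (auto simp: is_path_def)
  have nb_x: "u = a \<or> u = b" if "u \<in> W" "adj x u" for u
    using adj_nth_interior[OF pathW, of 1 u] that thin by simp
  have nb_b: "u = x \<or> u = d" if "u \<in> W" "adj b u" for u
    using adj_nth_interior[OF pathW, of 2 u] that thin by (simp add: numeral_2_eq_2)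
  have xab: "adj a x" "adj x b" "adj x a" "adj b x"
    using succ adj_sym[of a x] adj_sym[of x b] by auto
  have not_ba: "\<not> adj b a" using nb_b[of a] dist inW by auto
  then have not_ab: "\<not> adj a b" using adj_sym by blast
  have irr: "\<not> adj u u" for u using irreflp_adj by (auto simp: irreflp_def)
  have sym: "symp ?E" unfolding symp_def contract_def using adj_sym by blast
  have card_nb: "card (nbrs ?E ?W v) = card (nbrs adj W v)" if v: "v \<in> ?W" for v
  proof -
    consider "v = a" | "v = b" | "v \<noteq> a" "v \<noteq> b" by blast
    then show ?thesis
    proof cases
      case 1
      have "nbrs ?E ?W v = insert b (nbrs adj W v - {x})"
        using 1 v inW dist by (auto simp: nbrs_def contract_def)
      moreover have "b \<notin> nbrs adj W v - {x}" "x \<in> nbrs adj W v"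
        using 1 not_ab not_ba xab inW by (auto simp: nbrs_def)
      ultimately show ?thesis using finite_W by (simp add: card_Suc_Diff1 del: card_Diff_insert)
    next
      case 2
      have "nbrs ?E ?W v = insert a (nbrs adj W v - {x})"
        using 2 v inW dist by (auto simp: nbrs_def contract_def)
      moreover have "a \<notin> nbrs adj W v - {x}" "x \<in> nbrs adj W v"
        using 2 not_ab not_ba xab inW by (auto simp: nbrs_def)
      ultimately show ?thesis using finite_W by (simp add: card_Suc_Diff1 del: card_Diff_insert)
    next
      case 3
      then have "\<not> adj v x" using nb_x[of v] v adj_sym by blast
      then have "nbrs ?E ?W v = nbrs adj W v"
        using 3 v by (auto simp: nbrs_def contract_def)
      then show ?thesis by simp
    qed
  qed
  show "min_degree_2_graph ?W ?E c"
  proof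
    show "finite ?W" using finite_W by simp
    show "symp ?E" by (rule sym)
    show "irreflp ?E" using dist irr by (auto simp: irreflp_def contract_def)
    show "2 \<le> card (nbrs ?E ?W v)" if "v \<in> ?W" for v
      using card_nb[OF that] degree_ge_2 that by simp
    have "(\<Sum>v\<in>?W. card (nbrs ?E ?W v) - 2) = (\<Sum>v\<in>?W. card (nbrs adj W v) - 2)"
      using card_nb by (intro sum.cong) auto
    also have "\<dots> = (\<Sum>v\<in>W. card (nbrs adj W v) - 2)"
      using thin sum.remove[OF finite_W inW(2), of "\<lambda>v. card (nbrs adj W v) - 2"] by (simp add: thin_def)
    finally show "(\<Sum>v\<in>?W. card (nbrs ?E ?W v) - 2) = 2 * c" using degree_excess by simp
  next
    fix S assume S: "S \<subseteq> ?W" "S \<noteq> {}" "S \<noteq> ?W"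
    show "\<exists>u\<in>S. \<exists>v\<in>?W - S. ?E u v"
    proof (cases "a \<in> S \<longleftrightarrow> b \<in> S")
      case False
      then show ?thesis using inW dist by (auto simp: contract_def)
    next
      case True
      \<comment> \<open>\<open>x\<close> is put on the side of its two neighbors \<open>a\<close>
        and \<open>b\<close>, so the edge leaving \<open>T\<close> avoids \<open>x\<close> and
        survives the contraction.\<close>
      define T where "T = (if a \<in> S then insert x S else S)"
      have "T \<subseteq> W" "T \<noteq> {}" "T \<noteq> W" using S inW by (auto simp: T_def)
      then obtain u v where uv: "u \<in> T" "v \<in> W - T" "adj u v" using boundary by meson
      have "u \<noteq> x"
        using uv nb_x[of v] True S(1) by (auto simp: T_def split: if_splits)
      moreover have "v \<noteq> x"
        using uv nb_x[of u] True S(1) inW adj_sym[of u v] by (auto simp: T_def split: if_splits)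
      ultimately have "u \<in> S" "v \<in> ?W - S" "?E u v"
        using uv by (auto simp: T_def contract_def split: if_splits)
      then show ?thesis by blast
    qed
  qed
  have "successively ?E (b # d # ps)"
  proof -
    have "successively adj (b # d # ps)" using succ by simp
    then show ?thesis using dist
      by (elim successively_mono) (auto simp: contract_def)
  qed
  then show "is_path ?E ?W (a # b # d # ps)"
    using dist inW by (auto simp: is_path_def contract_def)
qed

end

section \<open>Embedding sparse graphs\<close>

definition embedding :: "('a \<Rightarrow> 'a \<Rightarrow> bool) \<Rightarrow> 'a set \<Rightarrow> ('b \<Rightarrow> 'b \<Rightarrow> bool) \<Rightarrow> 'b set \<Rightarrow> ('a \<Rightarrow> 'b) \<Rightarrow> bool" where
  "embedding adj S r V f \<longleftrightarrow>
    inj_on f S \<and> f ` S \<subseteq> V \<and> (\<forall>u\<in>S. \<forall>v\<in>S. adj u v \<longrightarrow> r (f u) (f v))"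

context path_free_complement
begin

section \<open>Greedy embedding\<close>

definition good :: "'b set" where
  "good = {w \<in> V. card (nbrs (opp r) V w) < 4 * k}"

text \<open>Markov's inequality: the average degree of the complement is at most
  \<open>k - 2\<close>.\<close>

lemma card_bad_le: "4 * card (V - good) \<le> card V"
proof -
  have "card (V - good) * (4 * k) \<le> (\<Sum>w\<in>V - good. card (nbrs (opp r) V w))"
    by (rule sum_bounded_below[where K = "4 * k", simplified of_nat_id]) (auto simp: good_def)
  also have "\<dots> \<le> (\<Sum>w\<in>V. card (nbrs (opp r) V w))"
    using finite_V by (intro sum_mono2) auto
  also have "\<dots> \<le> (k - 2) * card V"
    using finite_V symp_opp[OF symp_r] irreflp_opp no_path by (rule sum_degree_path_free)
  also have "\<dots> \<le> k * card V" by simp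
  finally have "k * (4 * card (V - good)) \<le> k * card V" by (simp add: mult_ac)
  then show ?thesis using k_ge_2 by simp
qed

text \<open>
  A vertex that still has unplaced neighbors must go to \<^const>\<open>good\<close>, so that later vertices
  can be attached to it.
\<close>

definition partial_embedding :: "('a \<Rightarrow> 'a \<Rightarrow> bool) \<Rightarrow> 'a set \<Rightarrow> 'a set \<Rightarrow> ('a \<Rightarrow> 'b) \<Rightarrow> bool" where
  "partial_embedding adj W S f \<longleftrightarrow>
    embedding adj S r V f \<and> (\<forall>u\<in>S. \<forall>w\<in>W - S. adj u w \<longrightarrow> f u \<in> good)"

text \<open>\<open>room\<close> counts the forbidden places for \<open>v\<close>: those in use,
  those not adjacent to the image of a placed neighbor, and the bad ones if \<open>v\<close> still
  has unplaced neighbors. Placed neighbors of \<open>v\<close> have good images, since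
  \<open>v\<close> was unplaced; each excludes at most \<open>4 * k\<close> places.\<close>

lemma partial_embedding_insert:
  assumes adj: "symp adj" "irreflp adj" and S: "finite S" "v \<notin> S" "v \<in> W"
    and f: "partial_embedding adj W S f"
    and room: "card S + card (nbrs adj S v) * (4 * k) +
      (if \<exists>w\<in>W - insert v S. adj v w then card (V - good) else 0) < card V"
  shows "\<exists>f'. partial_embedding adj W (insert v S) f'"
proof -
  let ?ext = "\<exists>w\<in>W - insert v S. adj v w"
  define B where "B = (if ?ext then V - good else {})"
  define N where "N = (\<Union>u\<in>nbrs adj S v. nbrs (opp r) V (f u))"
  have f': "inj_on f S" "f ` S \<subseteq> V" "\<And>u w. u \<in> S \<Longrightarrow> w \<in> S \<Longrightarrow> adj u w \<Longrightarrow> r (f u) (f w)"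
    and inv: "\<And>u w. u \<in> S \<Longrightarrow> w \<in> W \<Longrightarrow> w \<notin> S \<Longrightarrow> adj u w \<Longrightarrow> f u \<in> good"
    using f by (auto simp: partial_embedding_def embedding_def)
  have nb: "u \<in> S" "adj u v" if "u \<in> nbrs adj S v" for u
    using that adj(1) by (auto simp: nbrs_def symp_def)
  have "card N \<le> (\<Sum>u\<in>nbrs adj S v. card (nbrs (opp r) V (f u)))"
    unfolding N_def using S(1) by (intro card_UN_le) simp
  also have "\<dots> \<le> card (nbrs adj S v) * (4 * k)"
  proof (rule sum_bounded_above[where K = "4 * k", simplified])
    fix u assume "u \<in> nbrs adj S v"
    then have "f u \<in> good" using inv[of u v] nb S by simp
    then show "card (nbrs (opp r) V (f u)) \<le> 4 * k" by (simp add: good_def)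
  qed
  finally have "card N \<le> card (nbrs adj S v) * (4 * k)" .
  moreover have "card (f ` S \<union> N \<union> B) \<le> card (f ` S) + card N + card B"
    by (meson add_mono card_Un_le le_trans order.refl)
  moreover have "card (f ` S) \<le> card S" using S(1) by (rule card_image_le)
  moreover have "card B = (if ?ext then card (V - good) else 0)" by (simp add: B_def)
  ultimately have "card (f ` S \<union> N \<union> B) < card V" using room by linarith
  moreover have "finite (f ` S \<union> N \<union> B)"
    using S(1) finite_V by (auto simp: N_def B_def)
  ultimately have "\<not> V \<subseteq> f ` S \<union> N \<union> B"
    using card_mono[of "f ` S \<union> N \<union> B" V] by linarith
  then obtain w where w: "w \<in> V" "w \<notin> f ` S" "w \<notin> N" "w \<notin> B" by auto
  have red: "r (f u) w" if "u \<in> S" "adj u v" for u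
  proof -
    have "u \<in> nbrs adj S v" using that adj(1) by (auto simp: nbrs_def symp_def)
    then have "\<not> opp r (f u) w" using w(1,3) by (auto simp: N_def nbrs_def)
    moreover have "f u \<noteq> w" using w(2) that(1) by auto
    ultimately show ?thesis by (simp add: opp_def)
  qed
  have red': "r w (f u)" if "u \<in> S" "adj v u" for u
    using red[of u] that adj(1) r_sym by (auto simp: symp_def)
  let ?g = "f(v := w)"
  have "\<not> adj v v" using adj(2) by (simp add: irreflp_def)
  have g: "?g v = w" "\<And>u. u \<in> S \<Longrightarrow> ?g u = f u" using S(2) by auto
  have "embedding adj (insert v S) r V ?g"
    unfolding embedding_def
  proof (intro conjI ballI impI)
    have "inj_on ?g S" using f'(1) S(2) by (simp add: inj_on_fun_updI w(2))
    then show "inj_on ?g (insert v S)" using S(2) w(2) by (auto simp: inj_on_def)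
    show "?g ` insert v S \<subseteq> V" using f'(2) w(1) S(2) by auto
    fix x y assume "x \<in> insert v S" "y \<in> insert v S" "adj x y"
    then show "r (?g x) (?g y)"
      using f'(3)[of x y] red[of x] red'[of y] g \<open>\<not> adj v v\<close> by (cases "x = v"; cases "y = v") auto
  qed
  moreover have "?g u \<in> good" if "u \<in> insert v S" "z \<in> W - insert v S" "adj u z" for u z
  proof (cases "u = v")
    case True
    then have ?ext using that by blast
    then have "w \<in> good" using w(1,4) by (simp add: B_def)
    then show ?thesis using True by simp
  next
    case False
    then show ?thesis using inv[of u z] that by auto
  qed
  ultimately show ?thesis unfolding partial_embedding_def by blast
qed

text \<open>A vertex of \<open>branch\<close>, placed first, has fewer than \<open>2 * c\<close>
  placed neighbors. A vertex of \<open>thin\<close> has at most two, and at most one if it must go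
  to \<open>good\<close>.\<close>

lemma embedding_if_short_thin_paths:
  assumes "min_degree_2_graph W adj c" and c: "0 < c" and V: "18 * k * c \<le> card V"
    and short: "\<And>xs. is_path adj (min_degree_2_graph.thin W adj) xs \<Longrightarrow> length xs \<le> 2 * k + k div 2 - 2"
  shows "\<exists>f. embedding adj W r V f"
proof -
  interpret min_degree_2_graph W adj c by fact
  define q where "q = k * c"
  have q: "k \<le> q" "c \<le> q" "2 * c \<le> q" using c k_ge_2 by (auto simp: q_def)
  have V: "18 * q \<le> card V" using V by (simp add: q_def mult_ac)
  note bad = card_bad_le
  have step: "\<exists>f'. partial_embedding adj W (insert v S) f'"
    if "finite S" "v \<notin> S" "v \<in> W" "partial_embedding adj W S f"
      and "card S + card (nbrs adj S v) * (4 * k) +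
        (if \<exists>w\<in>W - insert v S. adj v w then card (V - good) else 0) < card V" for S v f
    using partial_embedding_insert[OF symp_adj irreflp_adj that] .
  have "\<exists>f. partial_embedding adj W F f" if "F \<subseteq> branch" for F
  proof -
    have "finite F" using that finite_branch finite_subset by blast
    then show ?thesis using that
    proof (induction F)
      case empty
      show ?case by (simp add: partial_embedding_def embedding_def)
    next
      case (insert v F)
      then obtain f where f: "partial_embedding adj W F f" by auto
      have "card (insert v F) \<le> 2 * c"
        using card_mono[OF finite_branch insert.prems] card_branch_le by linarith
      then have "card F < 2 * c" using insert.hyps by simp
      then have "card F * (4 * k) \<le> 2 * c * (4 * k)" by (intro mult_le_mono1) simp
      also have "\<dots> = 8 * q" by (simp add: q_def)
      finally have "card F * (4 * k) \<le> 8 * q" .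
      moreover have "card (nbrs adj F v) \<le> card F"
        using insert.hyps by (intro card_mono) (auto simp: nbrs_def)
      then have "card (nbrs adj F v) * (4 * k) \<le> card F * (4 * k)" by (rule mult_le_mono1)
      moreover have "0 < q" using q k_ge_2 by linarith
      \<comment> \<open>In units of \<open>q\<close>: at most 1 for used places and 8 for placed
        neighbors, which is less than three quarters of 18.\<close>
      ultimately have "card F + card (nbrs adj F v) * (4 * k) + card (V - good) < card V"
        using \<open>card F < 2 * c\<close> q V bad by linarith
      moreover have "v \<in> W" using insert.prems W_split(4) by auto
      ultimately show ?case using step[OF insert.hyps(1,2) _ f] by (simp split: if_splits)
    qed
  qed
  then obtain f0 where f0: "partial_embedding adj W branch f0" by blast
  have "\<exists>f. partial_embedding adj W (F \<union> branch) f" if "F \<subseteq> thin" for F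
  proof -
    have "finite F" using that finite_thin finite_subset by blast
    then show ?thesis using that
    proof (induction F)
      case empty
      show ?case using f0 by auto
    next
      case (insert v F)
      then obtain f where f: "partial_embedding adj W (F \<union> branch) f" by auto
      let ?S = "F \<union> branch"
      have v: "v \<in> thin" "v \<notin> ?S" "v \<in> W" using insert W_split by auto
      have fin: "finite ?S" using insert finite_branch by auto
      have "card ?S \<le> card thin + card branch"
        by (meson add_mono card_Un_le card_mono finite_thin insert.prems insert_subset le_trans order.refl)
      also have "card thin \<le> 3 * c * (2 * k + k div 2 - 2)" using card_thin_le[OF c short] .
      finally have "2 * card ?S \<le> 3 * c * (2 * (2 * k + k div 2 - 2)) + 4 * c"
        using card_branch_le by (simp add: mult_ac)
      also have "2 * (2 * k + k div 2 - 2) \<le> 5 * k - 4" by linarith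
      finally have "2 * card ?S \<le> 3 * c * (5 * k - 4) + 4 * c" by simp
      also have "3 * c * (5 * k - 4) + 12 * c = 15 * q"
      proof -
        have "(5 * k - 4) + 4 = 5 * k" using k_ge_2 by simp
        then have "3 * c * ((5 * k - 4) + 4) = 3 * c * (5 * k)" by simp
        then show ?thesis by (simp add: q_def algebra_simps)
      qed
      then have "3 * c * (5 * k - 4) + 4 * c = 15 * q - 8 * c" by linarith
      finally have cS: "2 * card ?S + 8 * c \<le> 15 * q" using q by linarith
      have nb2: "card (nbrs adj W v) = 2" using v(1) by (simp add: thin_def)
      have fin_nb: "finite (nbrs adj W v)" using finite_W by simp
      have sub: "nbrs adj ?S v \<subseteq> nbrs adj W v"
        using insert.prems W_split by (auto simp: nbrs_def)
      \<comment> \<open>By \<open>cS\<close>, at most \<open>15/2 * q\<close> places are in use. One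
        placed neighbor adds \<open>4 * k \<le> 4 * q\<close> next to the quarter of bad places; two
        add \<open>8 * k\<close> with no bad places to avoid. Both totals stay below
        \<open>card V\<close>, which is at least \<open>18 * q\<close>.\<close>
      have "card ?S + card (nbrs adj ?S v) * (4 * k) +
        (if \<exists>w\<in>W - insert v ?S. adj v w then card (V - good) else 0) < card V"
      proof (cases "\<exists>w\<in>W - insert v ?S. adj v w")
        case True
        then obtain w where "w \<in> nbrs adj W v" "w \<notin> nbrs adj ?S v" by (auto simp: nbrs_def)
        then have "nbrs adj ?S v \<subset> nbrs adj W v" using sub by auto
        then have "card (nbrs adj ?S v) < 2" using psubset_card_mono[OF fin_nb] nb2 by metis
        then have "card (nbrs adj ?S v) \<le> 1" by simp
        then have "card (nbrs adj ?S v) * (4 * k) \<le> 1 * (4 * k)" by (rule mult_le_mono1)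
        then show ?thesis using True cS q V bad c by (simp only: if_True)
      next
        case False
        have "card (nbrs adj ?S v) \<le> 2" using card_mono[OF fin_nb sub] nb2 by simp
        then have "card (nbrs adj ?S v) * (4 * k) \<le> 2 * (4 * k)" by (rule mult_le_mono1)
        then show ?thesis using False cS q V c by (simp only: if_False)
      qed
      then show ?case using step[OF fin v(2,3) f] by simp
    qed
  qed
  then obtain f where "partial_embedding adj W (thin \<union> branch) f" by blast
  moreover have "thin \<union> branch = W" using W_split(1) by auto
  ultimately show ?thesis by (auto simp: partial_embedding_def)
qed

lemma embedding_uncontract:
  assumes "min_degree_2_graph W adj c" "is_path adj (min_degree_2_graph.thin W adj) (a # x # b # d # ps)"
    and f: "embedding (contract adj a x b) (W - {x}) r V f"
    and len: "2 * k + k div 2 \<le> length (a # x # b # d # ps) + 1"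
    and V: "card W + k div 2 \<le> card V + 1"
  shows "\<exists>g. embedding adj W r V g"
proof -
  interpret min_degree_2_graph W adj c by fact
  let ?xs = "a # x # b # d # ps" and ?E = "contract adj a x b" and ?W = "W - {x}"
  let ?ys = "a # b # d # ps"
  have path: "is_path adj thin ?xs" by fact
  then have pathW: "is_path adj W ?xs" using W_split(3) by (auto simp: is_path_def)
  have dist: "distinct ?xs" and xsW: "set ?xs \<subseteq> W" using pathW by (auto simp: is_path_def)
  have ys: "is_path ?E ?W ?ys" using contract_graph(2)[OF path] .
  have f': "inj_on f ?W" "f ` ?W \<subseteq> V" "\<And>u v. u \<in> ?W \<Longrightarrow> v \<in> ?W \<Longrightarrow> ?E u v \<Longrightarrow> r (f u) (f v)"
    using f by (auto simp: embedding_def)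
  have ysW: "set ?ys \<subseteq> ?W" "distinct ?ys" "successively ?E ?ys" using ys by (auto simp: is_path_def)
  let ?zs = "map f ?ys"
  have "successively (\<lambda>u v. r (f u) (f v)) ?ys"
    using ysW(3) by (rule successively_mono) (use f'(3) ysW(1) in auto)
  then have "successively r ?zs" by (simp only: successively_map)
  moreover have "distinct ?zs"
    using ysW(1,2) inj_on_subset[OF f'(1)] by (simp only: distinct_map)
  moreover have "set ?zs \<subseteq> V" using f'(2) ysW(1) by auto
  ultimately have zs: "is_path r V ?zs" unfolding is_path_def by blast
  \<comment> \<open>The copy of \<open>W - {x}\<close> uses \<open>card W - 1\<close> vertices,
    which leaves the \<open>k div 2\<close> free ones that absorption needs.\<close>
  let ?Y = "V - f ` ?W"
  have "card (f ` ?W) = card W - 1"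
    using f'(1) xsW finite_W by (simp add: card_image)
  then have "card ?Y = card V - (card W - 1)"
    using f'(2) finite_W by (simp add: card_Diff_subset)
  moreover have "0 < card W" using xsW finite_W by (auto simp: card_gt_0_iff)
  ultimately have "k div 2 \<le> card ?Y" using V by linarith
  moreover have "?Y \<inter> set ?zs = {}" using ysW(1) by auto
  moreover have "2 * k + k div 2 \<le> length ?zs + 2" using len by simp
  ultimately obtain y zs' where y: "y \<in> ?Y" and zs': "is_path r V zs'" "set zs' = insert y (set ?zs)"
    "hd zs' = hd ?zs" "last zs' = last ?zs"
    using absorb_vertex[OF zs, of ?Y] by blast
  have dist': "distinct zs'" using zs'(1) by (simp add: is_path_def)
  have y_new: "y \<notin> set ?zs" using y ysW(1) by auto
  have "length zs' = card (insert y (set ?zs))" using dist' zs'(2) distinct_card by metis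
  also have "\<dots> = Suc (length ?zs)" using y_new \<open>distinct ?zs\<close> distinct_card[of ?zs] by simp
  finally have len': "length zs' = length ?xs" by simp
  define g where "g v = (if v \<in> set ?xs then the (map_of (zip ?xs zs') v) else f v)" for v
  let ?n = "length ?xs"
  have g_nth: "g (?xs ! i) = zs' ! i" if "i < ?n" for i
  proof -
    have "i < length zs'" using that len' by (simp only:)
    from map_of_zip_nth[OF len'[symmetric] dist this] show ?thesis
      unfolding g_def using nth_mem[OF that] by (simp only: if_True option.sel)
  qed
  have g_out: "g v = f v" if "v \<notin> set ?xs" for v using that by (simp add: g_def)
  have ne': "zs' \<noteq> []" using len' by auto
  have "g a = f a" using g_nth[of 0] zs'(3) ne' by (simp add: hd_conv_nth)
  moreover have "g (last ?xs) = f (last ?xs)"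
  proof -
    have "last ?xs = ?xs ! (?n - 1)" by (rule last_conv_nth) simp
    then have "g (last ?xs) = last zs'" using g_nth[of "?n - 1"] len' ne' by (simp add: last_conv_nth)
    then show ?thesis using zs'(4) by (simp add: last_map)
  qed
  ultimately have g_f: "g v = f v" if "v \<notin> set ?xs \<or> v = a \<or> v = last ?xs" for v
    using that g_out by auto
  have interior: "\<exists>i. 0 < i \<and> Suc i < ?n \<and> v = ?xs ! i"
    if v: "v \<in> set ?xs" "v \<noteq> a" "v \<noteq> last ?xs" for v
  proof -
    obtain i where i: "i < ?n" "v = ?xs ! i" using v(1) by (metis in_set_conv_nth)
    have "i \<noteq> 0" using i v(2) by (cases i) auto
    moreover have "last ?xs = ?xs ! (?n - 1)" by (rule last_conv_nth) simp
    then have "i \<noteq> ?n - 1" using i v(3) by auto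
    ultimately show ?thesis using i by (intro exI[of _ i]) auto
  qed
  have red_interior: "r (g u) (g v)"
    if uv: "u \<in> set ?xs" "u \<noteq> a" "u \<noteq> last ?xs" "v \<in> W" "adj u v" for u v
  proof -
    obtain i where i: "0 < i" "Suc i < ?n" "u = ?xs ! i" using interior uv(1-3) by blast
    have "u \<in> thin" using uv(1) path by (auto simp: is_path_def)
    then have "v = ?xs ! (i - 1) \<or> v = ?xs ! Suc i"
      using adj_nth_interior[OF pathW i(1,2)] \<open>u \<in> thin\<close> uv(4,5) unfolding i(3) by simp
    moreover have succ: "r (zs' ! j) (zs' ! Suc j)" if "Suc j < ?n" for j
      using zs'(1) that len' unfolding is_path_def successively_conv_nth by simp
    have "g u = zs' ! i" using g_nth[of i] i by simp
    moreover have "r (zs' ! (i - 1)) (zs' ! i)" using succ[of "i - 1"] i by simp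
    moreover have "g (?xs ! (i - 1)) = zs' ! (i - 1)" "g (?xs ! Suc i) = zs' ! Suc i"
      by (rule g_nth; use i in linarith)+
    ultimately show ?thesis using succ[OF i(2)] r_sym by metis
  qed
  have "embedding adj W r V g"
    unfolding embedding_def
  proof (intro conjI ballI impI)
    have img: "g ` set ?xs = set zs'"
    proof -
      have "map g ?xs = zs'"
      proof (rule nth_equalityI)
        show "length (map g ?xs) = length zs'" by (simp only: length_map len')
        fix i assume "i < length (map g ?xs)"
        then have i: "i < ?n" by (simp only: length_map)
        show "map g ?xs ! i = zs' ! i" by (simp only: nth_map[OF i] g_nth[OF i])
      qed
      then show ?thesis by (simp only: set_map[symmetric])
    qed
    have "inj_on g (set ?xs)"
    proof (rule eq_card_imp_inj_on)
      show "card (g ` set ?xs) = card (set ?xs)"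
        unfolding img using dist dist' len' by (simp only: distinct_card)
    qed simp
    moreover have "inj_on g (W - set ?xs)"
    proof -
      have "inj_on f (W - set ?xs)" by (rule inj_on_subset[OF f'(1)]) auto
      then show ?thesis by (rule inj_on_cong[THEN iffD1, rotated]) (simp only: g_out Diff_iff not_False_eq_True)
    qed
    moreover have img2: "g ` (W - set ?xs) = f ` (W - set ?xs)"
      by (rule image_cong[OF refl]) (simp only: g_out Diff_iff not_False_eq_True)
    have "set zs' \<inter> f ` (W - set ?xs) = {}"
    proof -
      have "y \<notin> f ` (W - set ?xs)" using y by auto
      moreover have "f u \<noteq> f v" if "u \<in> set ?ys" "v \<in> W - set ?xs" for u v
        using inj_onD[OF f'(1), of u v] that ysW(1) by auto
      ultimately show ?thesis using zs'(2) by auto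
    qed
    ultimately have "inj_on g (set ?xs \<union> (W - set ?xs))"
      unfolding inj_on_Un using img img2 by auto
    moreover have W_eq: "set ?xs \<union> (W - set ?xs) = W" using xsW by auto
    ultimately show "inj_on g W" by (simp only:)
    have "set zs' \<subseteq> V" using zs'(1) by (simp add: is_path_def)
    moreover have "f ` (W - set ?xs) \<subseteq> V" using f'(2) by auto
    ultimately have "g ` (set ?xs \<union> (W - set ?xs)) \<subseteq> V" unfolding image_Un img img2 by blast
    then show "g ` W \<subseteq> V" by (simp only: W_eq)
    fix u v assume uv: "u \<in> W" "v \<in> W" "adj u v"
    \<comment> \<open>\<open>?ends\<close> describes vertices where \<open>g\<close> agrees with
      \<open>f\<close>. It excludes \<open>x\<close>, so an edge between two of them survives the
      contraction.\<close>
    let ?ends = "\<lambda>v. v \<notin> set ?xs \<or> v = a \<or> v = last ?xs"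
    consider "\<not> ?ends u" | "\<not> ?ends v" | "?ends u" "?ends v" by blast
    then show "r (g u) (g v)"
    proof cases
      case 1
      then show ?thesis using red_interior uv by blast
    next
      case 2
      then show ?thesis using red_interior[of v u] uv adj_sym r_sym by blast
    next
      case 3
      have "x \<noteq> last ?xs" using dist by auto
      then have "u \<noteq> x" "v \<noteq> x" using 3 dist by auto
      then have "r (f u) (f v)" using f'(3)[of u v] uv by (simp add: contract_def)
      then show ?thesis using g_f 3 by simp
    qed
  qed
  then show ?thesis by blast
qed

text \<open>The host graph stays fixed during the induction. Contraction keeps \<open>c\<close> and
  lowers \<open>card W\<close>, so the size hypotheses are inherited.\<close>

lemma exists_embedding:
  assumes "min_degree_2_graph W adj c" "0 < c" "18 * k * c \<le> card V" "card W + k div 2 \<le> card V + 1"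
  shows "\<exists>f. embedding adj W r V f"
  using assms
proof (induction "card W" arbitrary: W adj rule: less_induct)
  case less
  interpret min_degree_2_graph W adj c by (rule less.prems)
  let ?m = "2 * k + k div 2 - 2"
  show ?case
  proof (cases "\<forall>xs. is_path adj thin xs \<longrightarrow> length xs \<le> ?m")
    case True
    then show ?thesis using embedding_if_short_thin_paths[OF less.prems(1-3)] by blast
  next
    case False
    then obtain xs where xs: "is_path adj thin xs" "?m < length xs" by auto
    \<comment> \<open>Contraction needs four path vertices; equality holds for
      \<open>k = 2\<close>.\<close>
    have "4 \<le> Suc ?m" using k_ge_2 by linarith
    then have "4 \<le> length xs" using xs(2) by linarith
    then obtain a x b d ps where eq: "xs = a # x # b # d # ps"
      by (auto simp: numeral_eq_Suc Suc_le_length_iff)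
    note path = xs(1)[unfolded eq]
    have "x \<in> W" using path W_split(3) by (auto simp: is_path_def)
    then have card: "card (W - {x}) < card W" using finite_W by (intro card_Diff1_less)
    have "\<exists>f. embedding (contract adj a x b) (W - {x}) r V f"
      using card less.prems(2-4) contract_graph(1)[OF path] by (intro less.hyps) auto
    then obtain f where "embedding (contract adj a x b) (W - {x}) r V f" ..
    moreover have "2 * k + k div 2 \<le> length (a # x # b # d # ps) + 1" using xs(2) unfolding eq by linarith
    ultimately show ?thesis using embedding_uncontract[OF less.prems(1) path _ _ less.prems(4)] by blast
  qed
qed

lemma exists_embedding_cycle:
  assumes "min_degree_2_graph W adj 0" "3 * k \<le> card W" "card W + k div 2 \<le> card V + 1"
  shows "\<exists>f. embedding adj W r V f"
proof -
  interpret min_degree_2_graph W adj 0 by fact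
  have "W \<noteq> {}" using assms(2) k_ge_2 by auto
  then obtain xs where xs: "distinct xs" "set xs = W"
    and adj: "\<And>i j. i < j \<Longrightarrow> j < length xs \<Longrightarrow> adj (xs ! i) (xs ! j) \<Longrightarrow> j = Suc i \<or> i = 0 \<and> j = length xs - 1"
    using hamiltonian_ordering by blast
  obtain cs where cs: "is_cycle r V cs" "length cs = card W"
    using exists_cycle_of_length[OF assms(2,3)] by blast
  have len: "length cs = length xs" using cs(2) xs distinct_card by fastforce
  have cs': "distinct cs" "set cs \<subseteq> V" "cs \<noteq> []" "successively r cs" "r (last cs) (hd cs)"
    using cs(1) by (auto simp: is_cycle_def is_path_def)
  define f where "f v = the (map_of (zip xs cs) v)" for v
  have f_nth: "f (xs ! i) = cs ! i" if "i < length xs" for i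
    using map_of_zip_nth[OF len[symmetric] xs(1), of i] that len by (simp add: f_def)
  have red: "r (f (xs ! i)) (f (xs ! j))" if "i < j" "j < length xs" "adj (xs ! i) (xs ! j)" for i j
  proof -
    have "j = Suc i \<or> i = 0 \<and> j = length xs - 1" using adj that by blast
    then show ?thesis
    proof
      assume "j = Suc i"
      then show ?thesis using cs'(4) that f_nth len by (simp add: successively_conv_nth)
    next
      assume "i = 0 \<and> j = length xs - 1"
      moreover have "xs \<noteq> []" using that by auto
      ultimately have "f (xs ! i) = hd cs" "f (xs ! j) = last cs"
        using f_nth[of i] f_nth[of j] that cs'(3) len by (simp_all add: hd_conv_nth last_conv_nth)
      then show ?thesis using cs'(5) r_sym by simp
    qed
  qed
  have "embedding adj W r V f"
    unfolding embedding_def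
  proof (intro conjI ballI impI)
    have "u = v" if "u \<in> W" "v \<in> W" "f u = f v" for u v
    proof -
      obtain i j where "i < length xs" "j < length xs" "u = xs ! i" "v = xs ! j"
        using \<open>u \<in> W\<close> \<open>v \<in> W\<close> xs(2) by (metis in_set_conv_nth)
      then show ?thesis using that(3) f_nth cs'(1) len by (simp add: nth_eq_iff_index_eq)
    qed
    then show "inj_on f W" by (auto simp: inj_on_def)
    show "f ` W \<subseteq> V"
    proof
      fix w assume "w \<in> f ` W"
      then obtain i where "i < length xs" "w = f (xs ! i)" using xs(2) by (metis imageE in_set_conv_nth)
      then show "w \<in> V" using f_nth len cs'(2) nth_mem[of i cs] by auto
    qed
    fix u v assume uv: "u \<in> W" "v \<in> W" "adj u v"
    then obtain i j where ij: "i < length xs" "j < length xs" "u = xs ! i" "v = xs ! j"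
      using xs(2) by (metis in_set_conv_nth)
    have "i \<noteq> j" using ij uv irreflp_adj by (auto simp: irreflp_def)
    then consider "i < j" | "j < i" by linarith
    then show "r (f u) (f v)"
    proof cases
      case 1
      then show ?thesis using red ij uv by simp
    next
      case 2
      have "adj (xs ! j) (xs ! i)" using adj_sym uv(3) ij by simp
      then show ?thesis using red[OF 2] ij r_sym by simp
    qed
  qed
  then show ?thesis by blast
qed

end

section \<open>The Ramsey number\<close>

lemma is_path_contains_copy:
  assumes "pair_graph H" "is_path (opp (\<lambda>u v. (u, v) \<in> parcs H)) (pverts H) xs" "k \<le> length xs"
  shows "contains_copy (complement_graph H) (path_graph k)"
proof -
  interpret pair_graph H by fact
  have xs: "distinct xs" "set xs \<subseteq> pverts H"
    and succ: "\<And>i. Suc i < length xs \<Longrightarrow> (xs ! i, xs ! Suc i) \<notin> parcs H"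
    using assms(2) by (auto simp: is_path_def successively_conv_nth opp_def)
  have mem: "xs ! i \<in> pverts H" if "i < k" for i
    using subsetD[OF xs(2) nth_mem, of i] that assms(3) by simp
  have arc: "(xs ! i, xs ! Suc i) \<in> parcs (complement_graph H)"
    "(xs ! Suc i, xs ! i) \<in> parcs (complement_graph H)" if "Suc i < k" for i
  proof -
    have "(xs ! i, xs ! Suc i) \<notin> parcs H" "xs ! i \<noteq> xs ! Suc i"
      using succ[of i] that assms(3) xs(1) by (simp_all add: nth_eq_iff_index_eq)
    moreover from this have "(xs ! Suc i, xs ! i) \<notin> parcs H" using arcs_symmetric by blast
    ultimately show "(xs ! i, xs ! Suc i) \<in> parcs (complement_graph H)"
      "(xs ! Suc i, xs ! i) \<in> parcs (complement_graph H)"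
      using mem[of i] mem[of "Suc i"] that by (auto simp: complement_graph_def)
  qed
  have "inj_on ((!) xs) {..<k}"
    using xs(1) assms(3) by (auto simp: inj_on_def nth_eq_iff_index_eq)
  then show ?thesis
    unfolding contains_copy_def using mem arc
    by (intro exI[of _ "(!) xs"]) (auto simp: path_graph_def complement_graph_def[of H, THEN arg_cong[of _ _ pverts]])
qed

text \<open>Arcs are grouped by their unordered edge; symmetry and looplessness give exactly two
  arcs per group.\<close>

lemma sum_out_degree_eq:
  assumes "pair_graph G"
  shows "(\<Sum>v\<in>pverts G. out_degree G v) = 2 * card (edges G)"
proof -
  interpret pair_graph G by fact
  let ?e = "\<lambda>(u, v). {u, v}"
  have "(\<Sum>v\<in>pverts G. out_degree G v) = card (\<Union>v\<in>pverts G. out_arcs G v)"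
    unfolding out_degree_def
    by (rule card_UN_disjoint[symmetric]) (auto simp: out_arcs_def pair_finite_verts pair_finite_arcs)
  also have "(\<Union>v\<in>pverts G. out_arcs G v) = parcs G"
    by (auto simp: out_arcs_def in_arcsD1)
  also have "card (parcs G) = (\<Sum>e\<in>edges G. card {a \<in> parcs G. ?e a = e})"
  proof -
    have "card (parcs G) = (\<Sum>e\<in>?e ` parcs G. card {a \<in> parcs G. ?e a = e})"
      using sum.image_gen[OF pair_finite_arcs, of "\<lambda>_. 1::nat" ?e] by simp
    moreover have "?e ` parcs G = edges G" by (force simp: edges_def)
    ultimately show ?thesis by simp
  qed
  also have "\<dots> = (\<Sum>e\<in>edges G. 2)"
  proof (rule sum.cong[OF refl])
    fix e assume "e \<in> edges G"
    then obtain u v where uv: "(u, v) \<in> parcs G" "e = {u, v}" by (auto simp: edges_def)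
    have "u \<noteq> v" using pair_no_loops[OF uv(1)] by simp
    moreover have "(v, u) \<in> parcs G" using arcs_symmetric uv(1) by blast
    then have "(x, y) \<in> parcs G \<and> {x, y} = {u, v} \<longleftrightarrow> x = u \<and> y = v \<or> x = v \<and> y = u" for x y
      unfolding doubleton_eq_iff using uv(1) by blast
    then have "{a \<in> parcs G. ?e a = e} = {(u, v), (v, u)}"
      by (simp add: set_eq_iff uv(2))
    ultimately show "card {a \<in> parcs G. ?e a = e} = 2" by simp
  qed
  finally show ?thesis by simp
qed

lemma connected_boundary:
  assumes "pair_graph G" "Digraph_Component.connected G" "S \<subseteq> pverts G" "S \<noteq> {}" "S \<noteq> pverts G"
  shows "\<exists>u\<in>S. \<exists>v\<in>pverts G - S. (u, v) \<in> parcs G"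
proof (rule ccontr)
  assume no: "\<not> ?thesis"
  interpret pair_graph G by fact
  obtain u v where uv: "u \<in> S" "v \<in> pverts G" "v \<notin> S" using assms(3-5) by auto
  \<comment> \<open>Connectedness means strong connectedness of the symmetric closure, which has the
    same reachability as the symmetric graph \<open>G\<close> itself.\<close>
  have "u \<rightarrow>\<^sup>*\<^bsub>mk_symmetric G\<^esub> v"
    using assms(2,3) uv by (auto simp: connected_def strongly_connected_def)
  then have "u \<rightarrow>\<^sup>*\<^bsub>with_proj G\<^esub> v"
    using reachable_mk_symmetric_eq[OF pair_sym_arcs] by simp
  then have "(u, v) \<in> rtrancl_on (pverts G) (parcs G)" by (simp add: reachable_def)
  then have "v \<in> S"
  proof (induction rule: rtrancl_on_induct)
    case base
    show ?case by fact
  next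
    case (step y z)
    then show ?case using no by blast
  qed
  then show False using uv by simp
qed

lemma min_degree_2_graphI:
  assumes "pair_graph G" "Digraph_Component.connected G" "2 \<le> min_degree G"
  obtains c where "min_degree_2_graph (pverts G) (\<lambda>u v. (u, v) \<in> parcs G) c"
    "card (edges G) = card (pverts G) + c"
proof -
  interpret pair_graph G by fact
  let ?adj = "\<lambda>u v. (u, v) \<in> parcs G" and ?W = "pverts G"
  have deg: "out_degree G v = card (nbrs ?adj ?W v)" for v
  proof -
    have "out_arcs G v = Pair v ` nbrs ?adj ?W v"
      by (auto simp: out_arcs_def nbrs_def in_arcsD2)
    then show ?thesis unfolding out_degree_def by (simp add: card_image inj_on_def)
  qed
  have deg2: "2 \<le> card (nbrs ?adj ?W v)" if "v \<in> ?W" for v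
  proof -
    have "min_degree G \<le> out_degree G v"
      unfolding min_degree_def using that pair_finite_verts by (intro Min_le) auto
    then show ?thesis using assms(3) deg by simp
  qed
  \<comment> \<open>The subtraction is not truncated: minimum degree 2 makes the degree sum
    \<open>2 * card (edges G)\<close> at least \<open>2 * card ?W\<close>.\<close>
  define c where "c = card (edges G) - card ?W"
  have sum: "(\<Sum>v\<in>?W. card (nbrs ?adj ?W v)) = 2 * card (edges G)"
    using sum_out_degree_eq[OF assms(1)] deg by simp
  have "(\<Sum>v\<in>?W. (card (nbrs ?adj ?W v) - 2) + 2) = (\<Sum>v\<in>?W. card (nbrs ?adj ?W v))"
    by (rule sum.cong[OF refl]) (use deg2 in fastforce)
  then have ex: "(\<Sum>v\<in>?W. card (nbrs ?adj ?W v) - 2) + 2 * card ?W = 2 * card (edges G)"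
    using sum by (simp only: sum.distrib sum_constant of_nat_id mult.commute)
  show thesis
  proof (rule that[of c])
    show "card (edges G) = card ?W + c" using ex by (simp add: c_def)
    show "min_degree_2_graph ?W ?adj c"
    proof
      show "finite ?W" by (rule pair_finite_verts)
      show "symp ?adj" by (auto simp: symp_def arcs_symmetric)
      show "irreflp ?adj" using pair_no_loops by (fastforce simp: irreflp_def)
      show "2 \<le> card (nbrs ?adj ?W v)" if "v \<in> ?W" for v by (rule deg2[OF that])
      show "(\<Sum>v\<in>?W. card (nbrs ?adj ?W v) - 2) = 2 * c" using ex by (simp add: c_def)
      show "\<exists>u\<in>S. \<exists>v\<in>?W - S. (u, v) \<in> parcs G" if "S \<subseteq> ?W" "S \<noteq> {}" "S \<noteq> ?W" for S
        using connected_boundary[OF assms(1,2) that] .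
    qed
  qed
qed

section \<open>The lower bound\<close>

lemma ramsey_lower_bound:
  fixes G :: "'a pair_pre_digraph"
  assumes "pair_graph G" "\<And>v. v \<in> pverts G \<Longrightarrow> \<exists>u. (v, u) \<in> parcs G" "0 < card (pverts G)" "2 \<le> k"
    and N: "N + 1 < card (pverts G) + k div 2"
  shows "\<exists>\<Gamma> :: nat pair_pre_digraph. pair_graph \<Gamma> \<and> card (pverts \<Gamma>) = N \<and>
    \<not> contains_copy \<Gamma> G \<and> \<not> contains_copy (complement_graph \<Gamma>) (path_graph k)"
proof -
  let ?n = "card (pverts G)"
  \<comment> \<open>If \<open>N < ?n - 1\<close>, this is the complete graph on all \<open>N\<close>
    vertices.\<close>
  define \<Gamma> :: "nat pair_pre_digraph" where "\<Gamma> = \<lparr> pverts = {..<N},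
    parcs = {(u, v). u < N \<and> v < N \<and> u < ?n - 1 \<and> v < ?n - 1 \<and> u \<noteq> v} \<rparr>"
  have "pair_graph \<Gamma>"
  proof
    show "finite (parcs \<Gamma>)"
      by (rule finite_subset[of _ "{..<N} \<times> {..<N}"]) (auto simp: \<Gamma>_def)
  qed (auto simp: \<Gamma>_def symmetric_def sym_def)
  moreover have "card (pverts \<Gamma>) = N" by (simp add: \<Gamma>_def)
  moreover have "\<not> contains_copy \<Gamma> G"
  proof
    assume "contains_copy \<Gamma> G"
    then obtain f where f: "inj_on f (pverts G)" "\<forall>(u, v)\<in>parcs G. (f u, f v) \<in> parcs \<Gamma>"
      by (auto simp: contains_copy_def)
    \<comment> \<open>Every vertex of \<open>G\<close> has a neighbor, so its image is not isolated
      and lies in the clique.\<close>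
    have "f ` pverts G \<subseteq> {..<?n - 1}"
    proof
      fix w assume "w \<in> f ` pverts G"
      then obtain v where v: "v \<in> pverts G" "w = f v" by auto
      then obtain u where "(v, u) \<in> parcs G" using assms(2) by blast
      then show "w \<in> {..<?n - 1}" using f(2) v(2) by (auto simp: \<Gamma>_def)
    qed
    then have "?n \<le> ?n - 1" using f(1) card_inj_on_le[of f "pverts G" "{..<?n - 1}"] by simp
    then show False using assms(3) by simp
  qed
  moreover have "\<not> contains_copy (complement_graph \<Gamma>) (path_graph k)"
  proof
    assume "contains_copy (complement_graph \<Gamma>) (path_graph k)"
    then obtain f where f: "inj_on f {..<k}" "f ` {..<k} \<subseteq> {..<N}"
      "\<forall>(u, v)\<in>parcs (path_graph k). (f u, f v) \<in> parcs (complement_graph \<Gamma>)"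
      by (auto simp: contains_copy_def path_graph_def complement_graph_def \<Gamma>_def)
    \<comment> \<open>The path contains \<open>k div 2\<close> disjoint edges, at positions
      \<open>2 * i\<close> and \<open>2 * i + 1\<close>. Each has an end outside the clique, but
      fewer than \<open>k div 2\<close> vertices lie there.\<close>
    have "\<exists>j\<in>{2 * i, 2 * i + 1}. ?n - 1 \<le> f j" if "i < k div 2" for i
    proof -
      have "(2 * i, 2 * i + 1) \<in> parcs (path_graph k)" using that by (auto simp: path_graph_def)
      then have "(f (2 * i), f (2 * i + 1)) \<in> parcs (complement_graph \<Gamma>)" using f(3) by blast
      then show ?thesis by (force simp: complement_graph_def \<Gamma>_def)
    qed
    then obtain j where j: "\<And>i. i < k div 2 \<Longrightarrow> j i \<in> {2 * i, 2 * i + 1} \<and> ?n - 1 \<le> f (j i)"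
      by metis
    have jk: "j i < k" "j i div 2 = i" if "i < k div 2" for i
      using j[OF that] that by auto
    have "inj_on (f \<circ> j) {..<k div 2}"
    proof (rule inj_onI)
      fix x y assume xy: "x \<in> {..<k div 2}" "y \<in> {..<k div 2}" "(f \<circ> j) x = (f \<circ> j) y"
      then have "j x = j y" using jk(1) inj_onD[OF f(1), of "j x" "j y"] by simp
      then show "x = y" using jk(2) xy(1,2) by (metis lessThan_iff)
    qed
    moreover have "(f \<circ> j) ` {..<k div 2} \<subseteq> {?n - 1..<N}"
      using j jk(1) f(2) by fastforce
    ultimately have "card {..<k div 2} \<le> card {?n - 1..<N}" by (rule card_inj_on_le) simp
    then have "k div 2 \<le> N - (?n - 1)" by simp
    then show False using N assms(3,4) by linarith
  qed
  ultimately show ?thesis by blast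
qed

theorem theorem1p8:
  fixes G :: "'a pair_pre_digraph" and k n :: nat
  assumes "k \<ge> 2" and "n \<ge> 3 * k"
    and "pair_graph G" and "Digraph_Component.connected G" and "card (pverts G) = n"
    and "min_degree G \<ge> 2"
    and "real (alpha' G) \<ge> real k / 2"
    and "real (card (edges G)) \<le> (1 + 1 / (18 * real k)) * real n"
  shows "ramsey_number G (path_graph k) = n + k div 2 - 1"
proof -
  let ?adj = "\<lambda>u v. (u, v) \<in> parcs G" and ?W = "pverts G"
  obtain c where G: "min_degree_2_graph ?W ?adj c" and c: "card (edges G) = card ?W + c"
    using min_degree_2_graphI[OF assms(3,4,6)] by blast
  interpret min_degree_2_graph ?W ?adj c by (rule G)
  \<comment> \<open>As \<open>G\<close> has \<open>n + c\<close> edges, the bound on their number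
    says that \<open>c\<close> is at most \<open>n / (18 * k)\<close>.\<close>
  have "real n + real c \<le> real n + real n / (18 * real k)"
    using assms(8) c assms(5) by (simp add: algebra_simps)
  then have "real c * (18 * real k) \<le> real n"
    using assms(1) by (simp add: field_simps)
  then have "real (18 * k * c) \<le> real n" by (simp add: mult_ac)
  then have excess: "18 * k * c \<le> n" by (simp only: of_nat_le_iff)
  have t: "1 \<le> k div 2" using assms(1) by simp
  show ?thesis
    unfolding ramsey_number_def
  proof (rule Least_equality)
    have "contains_copy \<Gamma> G \<or> contains_copy (complement_graph \<Gamma>) (path_graph k)"
      if \<Gamma>: "pair_graph \<Gamma>" "card (pverts \<Gamma>) = n + k div 2 - 1" for \<Gamma> :: "nat pair_pre_digraph"
    proof (rule disjCI)
      assume no: "\<not> contains_copy (complement_graph \<Gamma>) (path_graph k)"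
      interpret G: pair_graph G by (rule assms(3))
      interpret \<Gamma>: pair_graph \<Gamma> by (rule \<Gamma>(1))
      let ?r = "\<lambda>u v. (u, v) \<in> parcs \<Gamma>"
      interpret path_free_complement "pverts \<Gamma>" ?r k
      proof
        show "finite (pverts \<Gamma>)" by (rule \<Gamma>.pair_finite_verts)
        show "symp ?r" by (auto simp: symp_def \<Gamma>.arcs_symmetric)
        show "irreflp ?r" using \<Gamma>.pair_no_loops by (fastforce simp: irreflp_def)
        show "2 \<le> k" by (rule assms(1))
        show "length xs < k" if "is_path (opp ?r) (pverts \<Gamma>) xs" for xs
          using is_path_contains_copy[OF \<Gamma>(1) that] no by (meson not_less)
      qed
      have size: "card ?W + k div 2 \<le> card (pverts \<Gamma>) + 1" using \<Gamma>(2) assms(5) by linarith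
      have "\<exists>f. embedding ?adj ?W ?r (pverts \<Gamma>) f"
      proof (cases "c = 0")
        case True
        then show ?thesis using exists_embedding_cycle[OF _ _ size] G assms(2,5) by simp
      next
        case False
        moreover have "18 * k * c \<le> card (pverts \<Gamma>)" using excess \<Gamma>(2) t by linarith
        ultimately show ?thesis using exists_embedding[OF G _ _ size] by simp
      qed
      then obtain f where f: "inj_on f ?W" "f ` ?W \<subseteq> pverts \<Gamma>"
        "\<And>u v. u \<in> ?W \<Longrightarrow> v \<in> ?W \<Longrightarrow> (u, v) \<in> parcs G \<Longrightarrow> (f u, f v) \<in> parcs \<Gamma>"
        by (auto simp: embedding_def)
      have "(f u, f v) \<in> parcs \<Gamma>" if "(u, v) \<in> parcs G" for u v
        using f(3) that G.in_arcsD1[OF that] G.in_arcsD2[OF that] by simp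
      then show "contains_copy \<Gamma> G"
        using f(1,2) by (auto simp: contains_copy_def)
    qed
    then show "0 < n + k div 2 - 1 \<and> (\<forall>\<Gamma>::nat pair_pre_digraph. pair_graph \<Gamma> \<and> card (pverts \<Gamma>) = n + k div 2 - 1 \<longrightarrow>
        contains_copy \<Gamma> G \<or> contains_copy (complement_graph \<Gamma>) (path_graph k))"
      using assms(1,2) by auto
  next
    fix N
    assume N: "0 < N \<and> (\<forall>\<Gamma>::nat pair_pre_digraph. pair_graph \<Gamma> \<and> card (pverts \<Gamma>) = N \<longrightarrow>
        contains_copy \<Gamma> G \<or> contains_copy (complement_graph \<Gamma>) (path_graph k))"
    \<comment> \<open>Minimality requires a counterexample for every smaller \<open>N\<close>, and
      the lower bound supplies each of them.\<close>
    show "n + k div 2 - 1 \<le> N"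
    proof (rule ccontr)
      assume "\<not> n + k div 2 - 1 \<le> N"
      then have "N + 1 < card ?W + k div 2" using assms(5) by linarith
      moreover have "\<exists>u. (v, u) \<in> parcs G" if "v \<in> ?W" for v
      proof -
        have "nbrs ?adj ?W v \<noteq> {}" using degree_ge_2[OF that] by auto
        then show ?thesis by (auto simp: nbrs_def)
      qed
      moreover have "0 < card ?W" using assms(1,2,5) by simp
      ultimately show False using ramsey_lower_bound[OF assms(3) _ _ assms(1)] N by blast
    qed
  qed
qed

end
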